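(* Let $c\in\mathbb{C}\setminus\{0\}$ and let $f$ be an entire function of finite order $\rho(f)<\infty$ that is not $c$-periodic. If the lower order $\mu(f')$ of $f'$ satisfies $\mu(f')>\rho(f)-1/2$, then $$\sum_{a\in\mathbb{C}}\pi_c(a,f)\le 1-\delta(0,f').$$
   Context: $m(r,g)$ and $T(r,g)$ are the usual Nevanlinna proximity and characteristic functions. $f$ is $c$-periodic if $f(z+c)\equiv f(z)$. The order and lower order of $g$ are $\rho(g)=\limsup_{r\to\infty}\frac{\log T(r,g)}{\log r}$ and $\mu(g)=\liminf_{r\to\infty}\frac{\log T(r,g)}{\log r}$. The deficiency is $\delta(0,g)=\liminf_{r\to\infty}\frac{m(r,1/g)}{T(r,g)}$ (so $f'$ is understood to be nonconstant). For a meromorphic function $f$ that is not $c$-periodic and $a\in\mathbb{C}$, the $c$-separated index is $$\pi_c(a,f)=\liminf_{r\to\infty}\frac{N_c(r,a,f)}{T(r,f)},\qquad N_c(r,a,f)=\int_0^r\frac{n_c(t,a,f)-n_c(0,a,f)}{t}\,dt+n_c(0,a,f)\log r,$$ where $n_c(r,a,f)$ counts the points $z_0$ with $|z_0|\le r$ and $f(z_0)=a=f(z_0+c)$ (called $c$-separated $a$-pairs), each according to the number of equal terms at the beginning of the Taylor expansions of $f$ at $z_0$ and at $z_0+c$. *)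

theory Defs
  imports "HOL-Complex_Analysis.Complex_Analysis"
begin

definition log_plus :: "real \<Rightarrow> real" where
  "log_plus x = (if x \<le> 1 then 0 else ln x)"

definition proximity :: "real \<Rightarrow> (complex \<Rightarrow> complex) \<Rightarrow> real" where
  "proximity r g = 1 / (2 * pi) * integral {0..2 * pi} (\<lambda>t. log_plus (cmod (g (of_real r * cis t))))"

definition integrated_counting :: "(real \<Rightarrow> nat) \<Rightarrow> real \<Rightarrow> real" where
  "integrated_counting n r =
     integral {0..r} (\<lambda>t. (real (n t) - real (n 0)) / t) + real (n 0) * ln r"

text \<open>At a pole, the multiplicity is the negative of the (negative) library order \<^const>\<open>zorder\<close>.\<close>

definition pole_count :: "(complex \<Rightarrow> complex) \<Rightarrow> real \<Rightarrow> nat" where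
  "pole_count g r = (\<Sum>z\<in>{z. cmod z \<le> r \<and> is_pole g z}. nat (- zorder g z))"

definition characteristic :: "real \<Rightarrow> (complex \<Rightarrow> complex) \<Rightarrow> real" where
  "characteristic r g = proximity r g + integrated_counting (pole_count g) r"

definition growth_order :: "(complex \<Rightarrow> complex) \<Rightarrow> ereal" where
  "growth_order g = Limsup at_top (\<lambda>r::real. ereal (ln (characteristic r g) / ln r))"

definition lower_growth_order :: "(complex \<Rightarrow> complex) \<Rightarrow> ereal" where
  "lower_growth_order g = Liminf at_top (\<lambda>r::real. ereal (ln (characteristic r g) / ln r))"

definition deficiency_zero :: "(complex \<Rightarrow> complex) \<Rightarrow> ereal" where
  "deficiency_zero g =
     Liminf at_top (\<lambda>r::real. ereal (proximity r (\<lambda>z. 1 / g z) / characteristic r g))"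

text \<open>
  The following notions are meant for entire \<open>f\<close>. The multiplicity of a pair is the length of the
  common initial segment of the two Taylor expansions; that segment is finite unless \<open>f\<close> is
  \<open>c\<close>-periodic.
\<close>

definition pair_multiplicity :: "complex \<Rightarrow> (complex \<Rightarrow> complex) \<Rightarrow> complex \<Rightarrow> nat" where
  "pair_multiplicity c f z =
     card {k. \<forall>j\<le>k. fps_nth (fps_expansion f z) j = fps_nth (fps_expansion f (z + c)) j}"

definition pair_count :: "complex \<Rightarrow> complex \<Rightarrow> (complex \<Rightarrow> complex) \<Rightarrow> real \<Rightarrow> nat" where
  "pair_count c a f r =
     (\<Sum>z\<in>{z. cmod z \<le> r \<and> f z = a \<and> f (z + c) = a}. pair_multiplicity c f z)"

definition separated_index :: "complex \<Rightarrow> complex \<Rightarrow> (complex \<Rightarrow> complex) \<Rightarrow> ereal" where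
  "separated_index c a f =
     Liminf at_top (\<lambda>r::real. ereal (integrated_counting (pair_count c a f) r / characteristic r f))"

end

theory Submission
  imports Defs
begin

text \<open>
  Put \<open>g z = f (z + c) - f z\<close>. A pair counted with multiplicity \<open>k\<close> is a zero of \<open>g\<close> of order at
  least \<open>k\<close>, and pairs belonging to different values \<open>a\<close> are different points. By Jensen's formula
  the functions \<open>N_c(r, a, f)\<close> therefore add up to at most the mean of \<open>ln |g|\<close> over the circle
  \<open>|z| = r\<close>, up to a constant (\<open>sum_integrated_pair_count_le\<close>).

  Since \<open>g z\<close> is the integral of \<open>f'\<close> from \<open>z\<close> to \<open>z + c\<close>, the number \<open>ln |g z|\<close> exceeds
  \<open>ln |f' z|\<close> by at most \<open>ln |c|\<close> plus the largest increase of \<open>ln |f'|\<close> within distance \<open>|c|\<close>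
  of \<open>z\<close>. For entire functions \<open>T = m\<close>, and the mean of \<open>ln |f'|\<close> is \<open>m(r, f') - m(r, 1/f')\<close>.
  So once the increase is known to have mean \<open>o(T(r, f'))\<close>, the sum of the \<open>N_c(r, a, f)\<close> is at
  most \<open>(1 + o(1)) T(r, f') - m(r, 1/f')\<close>, which is at most \<open>(1 - \<delta> + o(1)) T(r, f')\<close>
  for \<open>\<delta> = \<delta>(0, f')\<close>. The same control of the increase of \<open>ln |f|\<close> within distance \<open>1\<close>,
  combined with Cauchy's estimate for \<open>f'\<close>, gives \<open>T(r, f') \<le> (1 + o(1)) T(r, f)\<close>. Dividing by
  \<open>T(r, f)\<close> yields the bound \<open>1 - \<delta>\<close>.

  The heart of the matter is thus \<open>entire_mean_distortion\<close>: if \<open>ln |F| \<le> A r^\<sigma>\<close> on large discs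
  of radius \<open>r\<close>, then the increase of \<open>ln |F|\<close> within a fixed distance \<open>K\<close> has mean
  \<open>O(1 + r^(\<sigma> - 1/2))\<close>. To see this, divide out the zeros in a disc of radius \<open>4 r\<close>. The
  logarithm of what remains has derivative \<open>O(r^(\<sigma> - 1))\<close> by the Borel-Caratheodory argument. A zero
  \<open>a\<close> contributes at most \<open>ln (1 + K / |z - a|) \<le> 2 sqrt (K / |z - a|)\<close>, whose mean over the circle
  is \<open>O(r^(-1/2))\<close> wherever \<open>a\<close> lies, and there are \<open>O(r^\<sigma>)\<close> zeros. The hypothesis
  \<open>\<mu>(f') > \<rho>(f) - 1/2\<close> leaves room for some \<open>\<sigma> > \<rho>(f)\<close> with \<open>r^(\<sigma> - 1/2) = o(T(r, f'))\<close>.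
  The bounded part of the error is absorbed because \<open>T(r, f')\<close> tends to infinity, so that polynomials
  are covered by the same argument.

  As the indices are lower limits, an inequality on an unbounded set of radii suffices. All estimates
  are made on circles that contain no zero of \<open>f\<close>, \<open>f'\<close> or \<open>g\<close>. This excludes only countably
  many radii, and on the remaining circles all logarithms are continuous.
\<close>

section \<open>Zeros of entire functions\<close>

lemma not_constant_onI:
  assumes "f x \<noteq> f y"
  shows "\<not> f constant_on UNIV"
proof
  assume "f constant_on UNIV"
  then obtain v where "\<And>z. f z = v"
    unfolding constant_on_def by auto
  then show False using assms by simp
qed

lemma holomorphic_difference:
  assumes "f holomorphic_on UNIV"
  shows "(\<lambda>z. f (z + c) - f z) holomorphic_on UNIV"
proof -
  have "f \<circ> (\<lambda>z. z + c) holomorphic_on UNIV"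
    by (rule holomorphic_on_compose_gen[OF _ assms]) (auto intro!: holomorphic_intros)
  then show ?thesis
    by (intro holomorphic_intros assms) (simp add: o_def)
qed

lemma entire_finite_zeros:
  assumes F: "F holomorphic_on UNIV" and nz: "F b \<noteq> 0"
  shows "finite {z \<in> cball c R. F z = 0}"
proof (cases "F constant_on UNIV")
  case True
  hence "F z \<noteq> 0" for z
    using nz unfolding constant_on_def by auto
  then show ?thesis by simp
next
  case False
  with F show ?thesis
    by (intro holomorphic_compact_finite_zeros) auto
qed

lemma entire_countable_zeros:
  assumes F: "F holomorphic_on UNIV" and nz: "F b \<noteq> 0"
  shows "countable {z. F z = 0}"
proof -
  have "{z. F z = 0} = (\<Union>k::nat. {z \<in> cball 0 (real k). F z = 0})"
  proof (intro equalityI subsetI)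
    fix z assume "z \<in> {z. F z = 0}"
    moreover obtain k :: nat where "cmod z \<le> real k"
      using real_arch_simple by blast
    ultimately show "z \<in> (\<Union>k::nat. {z \<in> cball 0 (real k). F z = 0})"
      by auto
  qed auto
  moreover have "countable \<dots>"
    by (rule countable_UN[OF countableI_type], rule countable_finite, rule entire_finite_zeros[OF assms])
  ultimately show ?thesis by simp
qed

lemma circle_avoiding_countable:
  assumes "countable Z" "x < y"
  obtains r where "x < r" "r < y" "\<And>z. cmod z = r \<Longrightarrow> z \<notin> Z"
proof -
  obtain r where r: "r \<in> {x<..<y}" "r \<notin> cmod ` Z"
    using real_interval_avoid_countable_set[OF assms(2) countable_image[OF assms(1)]] by blast
  then show ?thesis
    by (intro that[of r]) auto
qed

lemma entire_linear_factor:
  assumes F: "F holomorphic_on UNIV" and nz: "F b \<noteq> 0"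
  obtains n G where "G holomorphic_on UNIV" "G a \<noteq> 0" "\<And>z. F z = (z - a) ^ n * G z"
proof -
  define n where "n = nat (zorder F a)"
  define g where "g = zor_poly F a"
  obtain r where r: "r > 0" "g holomorphic_on cball a r"
    and eq: "\<And>w. w \<in> cball a r \<Longrightarrow> F w = g w * (w - a) ^ n \<and> g w \<noteq> 0"
    using zorder_exist_zero[OF F open_UNIV connected_UNIV UNIV_I, of a] nz unfolding n_def g_def by blast
  define G where "G = (\<lambda>w. if w = a then g a else F w / (w - a) ^ n)"
  have "G holomorphic_on (UNIV - {a})"
  proof (rule holomorphic_transform)
    show "(\<lambda>w. F w / (w - a) ^ n) holomorphic_on (UNIV - {a})"
      by (intro holomorphic_intros holomorphic_on_subset[OF F]) auto
  qed (auto simp: G_def)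
  moreover have "G holomorphic_on ball a r"
  proof (rule holomorphic_transform)
    show "g holomorphic_on ball a r"
      using r(2) by (rule holomorphic_on_subset) auto
    show "g w = G w" if "w \<in> ball a r" for w
      using eq[of w] that by (auto simp: G_def)
  qed
  ultimately have "G holomorphic_on ((UNIV - {a}) \<union> ball a r)"
    by (intro holomorphic_on_Un) (auto intro: open_delete)
  moreover have "(UNIV - {a}) \<union> ball a r = UNIV"
    using r by auto
  ultimately have "G holomorphic_on UNIV"
    by simp
  moreover have "G a \<noteq> 0"
    using eq[of a] r by (simp add: G_def)
  moreover have "F z = (z - a) ^ n * G z" for z
    using eq[of a] r by (cases "z = a") (auto simp: G_def)
  ultimately show ?thesis
    using that by blast
qed

text \<open>
  Exponents and cofactor come without reference to \<open>zorder\<close>. The exponent at \<open>a \<in> S\<close> is the order of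
  the zero because the cofactor does not vanish there, and this is the only property that is used to
  compare it with the multiplicity of a pair.
\<close>
lemma entire_finite_factorization:
  assumes F: "F holomorphic_on UNIV" and nz: "F b \<noteq> 0" and S: "finite S"
  obtains n G where "G holomorphic_on UNIV" "\<And>a. a \<in> S \<Longrightarrow> G a \<noteq> 0"
    "\<And>z. F z = (\<Prod>a\<in>S. (z - a) ^ n a) * G z"
proof -
  have "\<exists>n G. G holomorphic_on UNIV \<and> (\<forall>a\<in>S. G a \<noteq> 0) \<and> (\<forall>z. F z = (\<Prod>a\<in>S. (z - a) ^ n a) * G z)"
    using S
  proof induction
    case empty
    then show ?case using F by auto
  next
    case (insert a S)
    then obtain n G where G: "G holomorphic_on UNIV" "\<forall>a\<in>S. G a \<noteq> 0"
      and FG: "\<forall>z. F z = (\<Prod>a\<in>S. (z - a) ^ n a) * G z" by blast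
    have "G b \<noteq> 0"
      using FG nz by auto
    then obtain k G' where G': "G' holomorphic_on UNIV" "G' a \<noteq> 0" "\<And>z. G z = (z - a) ^ k * G' z"
      using entire_linear_factor[OF G(1)] by metis
    have "(\<Prod>b\<in>S. (z - b) ^ (n(a := k)) b) = (\<Prod>b\<in>S. (z - b) ^ n b)" for z
      by (intro prod.cong) (use insert in auto)
    hence "F z = (\<Prod>b\<in>insert a S. (z - b) ^ (n(a := k)) b) * G' z" for z
      using insert FG G'(3)[of z] by simp
    moreover have "\<forall>b\<in>insert a S. G' b \<noteq> 0"
      using G(2) G'(2,3) by auto
    ultimately show ?case
      using G'(1) by blast
  qed
  then show ?thesis using that by blast
qed

section \<open>Means over circles\<close>

definition circle_mean :: "real \<Rightarrow> (complex \<Rightarrow> real) \<Rightarrow> real" where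
  "circle_mean r u = 1 / (2 * pi) * integral {0..2 * pi} (\<lambda>t. u (of_real r * cis t))"

lemma circle_integrable:
  assumes "continuous_on (sphere 0 r) u" "0 \<le> r"
  shows "(\<lambda>t. u (of_real r * cis t) :: real) integrable_on {0..2 * pi}"
proof (rule integrable_continuous_interval)
  show "continuous_on {0..2 * pi} (\<lambda>t. u (of_real r * cis t))"
    by (rule continuous_on_compose2[OF assms(1)])
       (use assms(2) in \<open>auto intro!: continuous_intros simp: norm_mult\<close>)
qed

lemma circle_mean_mono:
  assumes "continuous_on (sphere 0 r) u" "continuous_on (sphere 0 r) v" "0 \<le> r"
    and "\<And>z. cmod z = r \<Longrightarrow> u z \<le> v z"
  shows "circle_mean r u \<le> circle_mean r v"
proof -
  have "integral {0..2 * pi} (\<lambda>t. u (of_real r * cis t)) \<le> integral {0..2 * pi} (\<lambda>t. v (of_real r * cis t))"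
    using assms by (intro integral_le circle_integrable) (auto simp: norm_mult)
  then show ?thesis
    unfolding circle_mean_def by (intro mult_left_mono) auto
qed

lemma circle_mean_cong:
  assumes "0 \<le> r" "\<And>z. cmod z = r \<Longrightarrow> u z = v z"
  shows "circle_mean r u = circle_mean r v"
  unfolding circle_mean_def using assms by (simp add: norm_mult)

lemma circle_mean_const [simp]: "circle_mean r (\<lambda>_. k) = k"
  by (simp add: circle_mean_def)

lemma circle_mean_add:
  assumes "continuous_on (sphere 0 r) u" "continuous_on (sphere 0 r) v" "0 \<le> r"
  shows "circle_mean r (\<lambda>z. u z + v z) = circle_mean r u + circle_mean r v"
  unfolding circle_mean_def
  by (subst integral_add) (use assms circle_integrable in \<open>auto simp: algebra_simps\<close>)

lemma circle_mean_cmult: "circle_mean r (\<lambda>z. k * u z) = k * circle_mean r u"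
  unfolding circle_mean_def by simp

lemma circle_mean_sum:
  assumes "finite A" "\<And>i. i \<in> A \<Longrightarrow> continuous_on (sphere 0 r) (u i)" "0 \<le> r"
  shows "circle_mean r (\<lambda>z. \<Sum>i\<in>A. u i z) = (\<Sum>i\<in>A. circle_mean r (u i))"
  using assms
proof (induction A rule: finite_induct)
  case (insert a A)
  then show ?case
    by (simp add: circle_mean_add continuous_on_sum)
qed simp

text \<open>
  This is Cauchy's integral formula in terms of the angle, where \<open>dz = \<i> z dt\<close>.
\<close>
lemma has_integral_Cauchy_circle:
  assumes h: "h holomorphic_on ball 0 R" and r: "0 < r" "r < R" and w: "cmod w < r"
  shows "((\<lambda>t. h (of_real r * cis t) * (of_real r * cis t / (of_real r * cis t - w)))
            has_integral 2 * of_real pi * h w) {0..2 * pi}"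
proof -
  have "h holomorphic_on cball 0 r"
    using h by (rule holomorphic_on_subset) (use r in auto)
  hence "((\<lambda>u. h u / (u - w)) has_contour_integral (2 * of_real pi * \<i> * h w)) (circlepath 0 r)"
    using Cauchy_integral_circlepath_simple[of h 0 r w] w by simp
  hence "((\<lambda>t. h (of_real r * cis t) / (of_real r * cis t - w) * of_real r * \<i> * cis t)
            has_integral 2 * of_real pi * \<i> * h w) {0..2 * pi}"
    unfolding circlepath_def
    using has_contour_integral_part_circlepath_iff[of 0 "2*pi" "\<lambda>u. h u / (u - w)" _ 0 r] by simp
  hence "((\<lambda>t. -\<i> * (h (of_real r * cis t) / (of_real r * cis t - w) * of_real r * \<i> * cis t))
            has_integral -\<i> * (2 * of_real pi * \<i> * h w)) {0..2 * pi}"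
    by (rule has_integral_mult_right)
  moreover have I: "-\<i> * (x * \<i> * y) = x * y" for x y
    by (simp add: complex_eq_iff)
  moreover have "-\<i> * (h (of_real r * cis t) / (of_real r * cis t - w) * of_real r * \<i> * cis t)
      = h (of_real r * cis t) * (of_real r * cis t / (of_real r * cis t - w))" for t
    unfolding I by simp
  ultimately show ?thesis by (simp only: I)
qed

text \<open>
  On \<open>|z| = r\<close> the Poisson kernel is the sum of the Cauchy kernel \<open>z / (z - w)\<close> and of
  \<open>cnj w * z / (r\<^sup>2 - cnj w * z)\<close>. The second term is holomorphic in the disc and vanishes at \<open>0\<close>,
  so it adds nothing to the integral. As the sum is real, one may pass to real parts.
\<close>
lemma Poisson_integral_formula:
  assumes h: "h holomorphic_on ball 0 R" and r: "0 < r" "r < R" and w: "cmod w < r"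
  shows "((\<lambda>t. Re (h (of_real r * cis t)) * ((r\<^sup>2 - (cmod w)\<^sup>2) / (cmod (of_real r * cis t - w))\<^sup>2))
            has_integral 2 * pi * Re (h w)) {0..2 * pi}"
proof -
  \<comment> \<open>a radius within which the second kernel has no pole\<close>
  define R' where "R' = (if w = 0 then R else min R (r\<^sup>2 / cmod w))"
  have R': "r < R'" "R' \<le> R"
    using r w by (auto simp: R'_def field_simps power2_eq_square)
  have den: "of_real (r\<^sup>2) - cnj w * z \<noteq> 0" if "z \<in> ball 0 R'" for z
  proof
    assume "of_real (r\<^sup>2) - cnj w * z = 0"
    hence "of_real (r\<^sup>2) = cnj w * z" by simp
    hence "cmod (of_real (r\<^sup>2)) = cmod w * cmod z"
      by (simp only: norm_mult complex_mod_cnj)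
    hence "r\<^sup>2 = cmod w * cmod z"
      by (simp add: norm_power)
    moreover have "cmod w * cmod z < r\<^sup>2"
      using that r by (cases "w = 0") (auto simp: R'_def field_simps)
    ultimately show False by simp
  qed
  define k where "k = (\<lambda>z. h z * (cnj w * z / (of_real (r\<^sup>2) - cnj w * z)))"
  have "k holomorphic_on ball 0 R'"
    unfolding k_def using den
    by (intro holomorphic_intros holomorphic_on_subset[OF h]) (use R' in auto)
  from has_integral_Cauchy_circle[OF this r(1) R'(1), of 0]
  have "((\<lambda>t. k (of_real r * cis t)) has_integral 0) {0..2 * pi}"
    using r by (simp add: k_def)
  from has_integral_add[OF has_integral_Cauchy_circle[OF h r w] this]
  have sum: "((\<lambda>t. h (of_real r * cis t) * (of_real r * cis t / (of_real r * cis t - w)) + k (of_real r * cis t))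
           has_integral (2 * of_real pi * h w)) {0..2 * pi}"
    by simp
  have *: "h z * (z / (z - w)) + k z = h z * of_real ((r\<^sup>2 - (cmod w)\<^sup>2) / (cmod (z - w))\<^sup>2)"
    if "cmod z = r" for z
  proof -
    have zw: "z - w \<noteq> 0" "cnj z - cnj w \<noteq> 0" "z \<noteq> 0"
      using that w r by (auto simp flip: complex_cnj_diff)
    have r2: "(of_real r)\<^sup>2 = z * cnj z"
      using complex_norm_square[of z] that by simp
    have "of_real (r\<^sup>2) - cnj w * z = (cnj z - cnj w) * z"
      by (simp add: r2 algebra_simps)
    hence "cnj w * z / (of_real (r\<^sup>2) - cnj w * z) = cnj w / (cnj z - cnj w)"
      using zw by simp
    hence "h z * (z / (z - w)) + k z = h z * (z / (z - w) + cnj w / (cnj z - cnj w))"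
      by (simp only: k_def distrib_left)
    also have "z / (z - w) + cnj w / (cnj z - cnj w)
        = (z * (cnj z - cnj w) + cnj w * (z - w)) / ((z - w) * (cnj z - cnj w))"
      by (rule add_frac_eq[OF zw(1,2)])
    also have "\<dots> = (z * cnj z - w * cnj w) / ((z - w) * cnj (z - w))"
      by (simp add: algebra_simps)
    also have "\<dots> = ((of_real r)\<^sup>2 - (of_real (cmod w))\<^sup>2) / (of_real (cmod (z - w)))\<^sup>2"
      by (simp only: complex_norm_square[symmetric] that of_real_power[symmetric])
    also have "\<dots> = of_real ((r\<^sup>2 - (cmod w)\<^sup>2) / (cmod (z - w))\<^sup>2)"
      by simp
    finally show ?thesis .
  qed
  have "h (of_real r * cis t) * (of_real r * cis t / (of_real r * cis t - w)) + k (of_real r * cis t)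
      = h (of_real r * cis t) * of_real ((r\<^sup>2 - (cmod w)\<^sup>2) / (cmod (of_real r * cis t - w))\<^sup>2)" for t
    by (rule *) (use r in \<open>simp add: norm_mult\<close>)
  with sum have "((\<lambda>t. h (of_real r * cis t) * of_real ((r\<^sup>2 - (cmod w)\<^sup>2) / (cmod (of_real r * cis t - w))\<^sup>2))
           has_integral (2 * of_real pi * h w)) {0..2 * pi}"
    by (simp only:)
  from has_integral_Re[OF this] show ?thesis by simp
qed

lemma circle_mean_Re_holomorphic:
  assumes "h holomorphic_on ball 0 R" "0 < r" "r < R"
  shows "circle_mean r (\<lambda>z. Re (h z)) = Re (h 0)"
proof -
  have "((\<lambda>t. Re (h (of_real r * cis t))) has_integral 2 * pi * Re (h 0)) {0..2 * pi}"
    using Poisson_integral_formula[OF assms, of 0] assms by (simp add: norm_mult)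
  then show ?thesis
    by (simp add: circle_mean_def integral_unique)
qed

text \<open>
  For \<open>|w| \<le> r / 2\<close> the Poisson kernel is nonnegative and at most \<open>(r + |w|) / (r - |w|) \<le> 3\<close>.
\<close>
lemma Poisson_le_circle_mean:
  assumes h: "h holomorphic_on ball 0 R" "0 < r" "r < R" and w: "2 * cmod w \<le> r"
    and v: "continuous_on (sphere 0 r) v" "\<And>z. cmod z = r \<Longrightarrow> 0 \<le> v z" "\<And>z. cmod z = r \<Longrightarrow> Re (h z) \<le> v z"
  shows "Re (h w) \<le> 3 * circle_mean r v"
proof -
  have "cmod w < r" using w h by auto
  note P = Poisson_integral_formula[OF h this]
  have "2 * pi * Re (h w) \<le> integral {0..2 * pi} (\<lambda>t. 3 * v (of_real r * cis t))"
  proof (rule has_integral_le[OF P])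
    show "((\<lambda>t. 3 * v (of_real r * cis t)) has_integral integral {0..2 * pi} (\<lambda>t. 3 * v (of_real r * cis t))) {0..2 * pi}"
      by (intro integrable_integral integrable_on_mult_right circle_integrable v) (use h in auto)
    fix t :: real
    define z where "z = of_real r * cis t"
    have z: "cmod z = r" using h by (simp add: z_def norm_mult)
    have d: "r - cmod w \<le> cmod (z - w)"
      using norm_triangle_ineq2[of z w] z by simp
    have "(r\<^sup>2 - (cmod w)\<^sup>2) / (cmod (z - w))\<^sup>2 \<le> (r\<^sup>2 - (cmod w)\<^sup>2) / (r - cmod w)\<^sup>2"
      using d w \<open>cmod w < r\<close> by (intro divide_left_mono power_mono) (auto intro!: power_mono mult_pos_pos)
    also have "\<dots> = (r + cmod w) / (r - cmod w)"
      using \<open>cmod w < r\<close> by (simp add: power2_eq_square square_diff_square_factored)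
    also have "\<dots> \<le> 3"
      using \<open>cmod w < r\<close> w by (simp add: divide_simps)
    finally have K: "(r\<^sup>2 - (cmod w)\<^sup>2) / (cmod (z - w))\<^sup>2 \<le> 3" .
    have K0: "0 \<le> (r\<^sup>2 - (cmod w)\<^sup>2) / (cmod (z - w))\<^sup>2"
      using \<open>cmod w < r\<close> by (intro divide_nonneg_nonneg) (auto intro: power_mono)
    have "Re (h z) * ((r\<^sup>2 - (cmod w)\<^sup>2) / (cmod (z - w))\<^sup>2) \<le> v z * ((r\<^sup>2 - (cmod w)\<^sup>2) / (cmod (z - w))\<^sup>2)"
      by (rule mult_right_mono[OF v(3)[OF z] K0])
    also have "\<dots> \<le> v z * 3"
      by (rule mult_left_mono[OF K v(2)[OF z]])
    finally show "Re (h (of_real r * cis t)) * ((r\<^sup>2 - (cmod w)\<^sup>2) / (cmod (of_real r * cis t - w))\<^sup>2)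
          \<le> 3 * v (of_real r * cis t)"
      by (simp add: z_def mult.commute)
  qed
  then show ?thesis
    by (simp add: circle_mean_def field_simps)
qed

section \<open>Jensen's formula and the proximity function\<close>

text \<open>
  For \<open>|a| < r\<close> this says that the Blaschke factor \<open>r * (z - a) / (r\<^sup>2 - cnj a * z)\<close> has modulus \<open>1\<close> on
  \<open>|z| = r\<close> and modulus at most \<open>1\<close> inside.
\<close>
lemma Blaschke_identity:
  "(cmod (of_real (r\<^sup>2) - cnj a * z))\<^sup>2 = (r * cmod (z - a))\<^sup>2 + (r\<^sup>2 - (cmod a)\<^sup>2) * (r\<^sup>2 - (cmod z)\<^sup>2)"
  unfolding power_mult_distrib cmod_power2
  by (simp add: power2_eq_square algebra_simps)

text \<open>
  Replacing each factor \<open>z - a\<close> by \<open>(r\<^sup>2 - cnj a * z) / r\<close> removes the zeros in the disc. It leaves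
  \<open>|F|\<close> unchanged on the circle and can only increase it inside. The new function has a holomorphic
  logarithm \<open>h\<close> on a slightly larger disc, so that \<open>Re h\<close> is a harmonic majorant of \<open>ln |F|\<close>
  with the same boundary values. Its mean value at \<open>0\<close> gives Jensen's formula, and its Poisson integral
  bounds \<open>|F|\<close> in terms of the proximity function.
\<close>
lemma Blaschke_logarithm:
  assumes F: "F holomorphic_on UNIV" and r: "0 < r" and nz: "\<And>z. cmod z = r \<Longrightarrow> F z \<noteq> 0"
  obtains S n G h R where "finite S" "S = {z. cmod z < r \<and> F z = 0}" "r < R" "h holomorphic_on ball 0 R"
    "G holomorphic_on UNIV" "\<And>a. a \<in> S \<Longrightarrow> G a \<noteq> 0" "\<And>z. F z = (\<Prod>a\<in>S. (z - a) ^ n a) * G z"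
    "\<And>z. cmod z = r \<Longrightarrow> ln (cmod (F z)) = Re (h z)"
    "\<And>z. cmod z < r \<Longrightarrow> F z \<noteq> 0 \<Longrightarrow> ln (cmod (F z)) \<le> Re (h z)"
    "F 0 \<noteq> 0 \<Longrightarrow> Re (h 0) = ln (cmod (F 0)) + (\<Sum>a\<in>S. n a * ln (r / cmod a))"
proof -
  define S where "S = {z. cmod z < r \<and> F z = 0}"
  have Fr: "F (of_real r) \<noteq> 0" using nz[of "of_real r"] r by simp
  have fin: "finite S"
    by (rule finite_subset[OF _ entire_finite_zeros[OF F Fr, of 0 r]]) (auto simp: S_def)
  obtain n G where G: "G holomorphic_on UNIV" "\<And>a. a \<in> S \<Longrightarrow> G a \<noteq> 0"
    and FG: "\<And>z. F z = (\<Prod>a\<in>S. (z - a) ^ n a) * G z"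
    using entire_finite_factorization[OF F Fr fin] by metis
  have G0: "G z \<noteq> 0" if "cmod z \<le> r" for z
  proof (cases "F z = 0")
    case True
    hence "z \<in> S" using nz[of z] that by (force simp: S_def)
    then show ?thesis by (rule G)
  qed (use FG[of z] in auto)
  define B where "B = (\<lambda>a z. (of_real (r\<^sup>2) - cnj a * z) / of_real r)"
  have B: "r * cmod (B a z) = cmod (of_real (r\<^sup>2) - cnj a * z)" for a z
    using r by (simp add: B_def norm_divide)
  have B_ge: "cmod (z - a) \<le> cmod (B a z)" if "cmod a < r" "cmod z \<le> r" for a z
  proof -
    have "0 \<le> (r\<^sup>2 - (cmod a)\<^sup>2) * (r\<^sup>2 - (cmod z)\<^sup>2)"
      using that by (intro mult_nonneg_nonneg) (auto intro!: power_mono)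
    hence "(r * cmod (z - a))\<^sup>2 \<le> (r * cmod (B a z))\<^sup>2"
      unfolding B Blaschke_identity by simp
    hence "r * cmod (z - a) \<le> r * cmod (B a z)"
      by (rule power2_le_imp_le) (use r in auto)
    then show ?thesis using r by simp
  qed
  have B_eq: "cmod (B a z) = cmod (z - a)" if "cmod z = r" for a z
  proof -
    have "(r * cmod (B a z))\<^sup>2 = (r * cmod (z - a))\<^sup>2"
      unfolding B Blaschke_identity using that by simp
    hence "r * cmod (B a z) = r * cmod (z - a)"
      by (rule power2_eq_imp_eq) (use r in auto)
    then show ?thesis using r by simp
  qed
  have B0: "B a z \<noteq> 0" if "a \<in> S" "cmod z \<le> r" for a z
  proof (cases "z = a")
    case True
    have "(cmod a)\<^sup>2 < r\<^sup>2" using that by (intro power_strict_mono) (auto simp: S_def)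
    hence "r\<^sup>2 - (cmod a)\<^sup>2 \<noteq> 0" by simp
    moreover have "of_real (r\<^sup>2) - cnj a * a = of_real (r\<^sup>2 - (cmod a)\<^sup>2)"
      using complex_norm_square[of a] by (simp add: mult.commute)
    ultimately show ?thesis using r True unfolding B_def
      by (metis divide_eq_0_iff less_irrefl of_real_eq_0_iff)
  next
    case False
    then show ?thesis using B_ge[of a z] that by (auto simp: S_def)
  qed
  define E where "E = (\<lambda>z. G z * (\<Prod>a\<in>S. B a z ^ n a))"
  have E_hol: "E holomorphic_on UNIV"
    unfolding E_def B_def by (intro holomorphic_intros G) (use r in auto)
  have "open {z. E z \<noteq> 0}"
    using holomorphic_on_imp_continuous_on[OF E_hol]
    by (intro open_Collect_neq continuous_on_const) auto
  moreover have "cball 0 r \<subseteq> {z. E z \<noteq> 0}"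
    using G0 B0 fin by (auto simp: E_def)
  \<comment> \<open>by compactness there are no zeros in a slightly larger disc either, where the logarithm is taken\<close>
  ultimately obtain e where e: "e > 0" "(\<Union>x\<in>cball 0 r. ball x e) \<subseteq> {z. E z \<noteq> 0}"
    by (rule compact_subset_open_imp_ball_epsilon_subset[OF compact_cball])
  have E0: "E z \<noteq> 0" if z: "z \<in> ball 0 (r + e)" for z
  proof (cases "cmod z \<le> r")
    case True
    then show ?thesis using e by force
  next
    case False
    define x where "x = of_real (r / cmod z) * z"
    have "z \<noteq> 0" using False r by (metis less_imp_le norm_zero)
    hence "cmod x = r" using False r by (auto simp: x_def norm_mult norm_divide)
    moreover have "dist x z < e"
    proof -
      have "x - z = of_real (r / cmod z - 1) * z" by (simp add: x_def algebra_simps)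
      hence "dist x z = \<bar>r / cmod z - 1\<bar> * cmod z"
        by (simp only: dist_norm norm_mult norm_of_real)
      also have "\<dots> = cmod z - r" using False r \<open>z \<noteq> 0\<close> by (simp add: field_simps abs_if)
      finally show ?thesis using z by simp
    qed
    ultimately show ?thesis using e by force
  qed
  obtain h where h: "h holomorphic_on ball 0 (r + e)" "\<And>z. z \<in> ball 0 (r + e) \<Longrightarrow> E z = exp (h z)"
    using contractible_imp_holomorphic_log[of E "ball 0 (r + e)"] E0
      holomorphic_on_subset[OF E_hol] convex_imp_contractible[OF convex_ball] by blast
  have Re_h: "Re (h z) = ln (cmod (E z))" if "cmod z \<le> r" for z
    using h(2)[of z] that e by (simp add: norm_exp_eq_Re)
  have modE: "cmod (E z) = cmod (G z) * (\<Prod>a\<in>S. cmod (B a z) ^ n a)" for z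
    by (simp add: E_def norm_mult prod_norm[symmetric] norm_power)
  have modF: "cmod (F z) = cmod (G z) * (\<Prod>a\<in>S. cmod (z - a) ^ n a)" for z
    by (simp add: FG norm_mult prod_norm[symmetric] norm_power)
  show ?thesis
  proof
    show "finite S" "S = {z. cmod z < r \<and> F z = 0}" "r < r + e" "h holomorphic_on ball 0 (r + e)"
      using fin S_def e h by auto
    show "G holomorphic_on UNIV" "\<And>a. a \<in> S \<Longrightarrow> G a \<noteq> 0" "\<And>z. F z = (\<Prod>a\<in>S. (z - a) ^ n a) * G z"
      using G FG by auto
    show "ln (cmod (F z)) = Re (h z)" if "cmod z = r" for z
      using that by (simp add: Re_h modE modF B_eq)
    show "ln (cmod (F z)) \<le> Re (h z)" if "cmod z < r" "F z \<noteq> 0" for z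
    proof -
      have "cmod (F z) \<le> cmod (E z)"
        unfolding modE modF using that B_ge
        by (intro mult_left_mono prod_mono conjI power_mono) (auto simp: S_def)
      then have "ln (cmod (F z)) \<le> ln (cmod (E z))"
        using that by (intro ln_mono) auto
      then show ?thesis
        using that by (simp add: Re_h)
    qed
    show "Re (h 0) = ln (cmod (F 0)) + (\<Sum>a\<in>S. n a * ln (r / cmod a))" if F0: "F 0 \<noteq> 0"
    proof -
      have S0: "a \<noteq> 0" if "a \<in> S" for a using that F0 by (auto simp: S_def)
      have "ln (\<Prod>a\<in>S. r ^ n a) = (\<Sum>a\<in>S. n a * ln r)" "ln (\<Prod>a\<in>S. cmod a ^ n a) = (\<Sum>a\<in>S. n a * ln (cmod a))"
        using r S0 fin by (auto simp: ln_prod ln_realpow)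
      moreover have "cmod (B a 0) = r" for a
        using r by (simp add: B_def norm_divide power2_eq_square norm_mult)
      ultimately have "Re (h 0) = ln (cmod (G 0)) + (\<Sum>a\<in>S. n a * ln r)"
        "ln (cmod (F 0)) = ln (cmod (G 0)) + (\<Sum>a\<in>S. n a * ln (cmod a))"
        using G0[of 0] r S0 fin by (simp_all add: Re_h modE modF ln_mult prod_pos)
      then show ?thesis
        using r S0 by (simp add: ln_div algebra_simps sum_subtractf)
    qed
  qed
qed

lemma proximity_eq_circle_mean: "proximity r g = circle_mean r (\<lambda>z. log_plus (cmod (g z)))"
  by (simp add: proximity_def circle_mean_def)

lemma log_plus_eq: "0 < x \<Longrightarrow> log_plus x = max 0 (ln x)"
  by (auto simp: log_plus_def max_def)

lemma continuous_on_ln_cmod: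
  assumes "F holomorphic_on UNIV" "\<And>z. cmod z = r \<Longrightarrow> F z \<noteq> 0"
  shows "continuous_on (sphere 0 r) (\<lambda>z. ln (cmod (F z)))"
  using assms
  by (intro continuous_intros holomorphic_on_imp_continuous_on[OF holomorphic_on_subset]) auto

lemma Jensen_formula:
  assumes F: "F holomorphic_on UNIV" and r: "0 < r" and nz: "\<And>z. cmod z = r \<Longrightarrow> F z \<noteq> 0" and F0: "F 0 \<noteq> 0"
  obtains S n G where "finite S" "S = {z. cmod z < r \<and> F z = 0}"
    "G holomorphic_on UNIV" "\<And>a. a \<in> S \<Longrightarrow> G a \<noteq> 0" "\<And>z. F z = (\<Prod>a\<in>S. (z - a) ^ n a) * G z"
    "circle_mean r (\<lambda>z. ln (cmod (F z))) = ln (cmod (F 0)) + (\<Sum>a\<in>S. n a * ln (r / cmod a))"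
proof (rule Blaschke_logarithm[OF F r nz])
  fix S n G h R
  assume S: "finite S" "S = {z. cmod z < r \<and> F z = 0}" and R: "r < R" and h: "h holomorphic_on ball 0 R"
    and G: "G holomorphic_on UNIV" "\<And>a. a \<in> S \<Longrightarrow> G a \<noteq> 0" "\<And>z. F z = (\<Prod>a\<in>S. (z - a) ^ n a) * G z"
    and h_eq: "\<And>z. cmod z = r \<Longrightarrow> ln (cmod (F z)) = Re (h z)"
    and h0: "F 0 \<noteq> 0 \<Longrightarrow> Re (h 0) = ln (cmod (F 0)) + (\<Sum>a\<in>S. real (n a) * ln (r / cmod a))"
  have "circle_mean r (\<lambda>z. ln (cmod (F z))) = circle_mean r (\<lambda>z. Re (h z))"
    using r h_eq by (intro circle_mean_cong) simp_all
  also have "\<dots> = Re (h 0)"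
    by (rule circle_mean_Re_holomorphic[OF h r R])
  also note h0[OF F0]
  finally show ?thesis
    using that[OF S G(1), of n] G(2,3) by blast
qed

text \<open>
  The maximum modulus of an entire function is controlled by its characteristic on a circle of twice
  the radius.
\<close>
lemma ln_cmod_le_proximity:
  assumes F: "F holomorphic_on UNIV" and r: "0 < r" and nz: "\<And>z. cmod z = r \<Longrightarrow> F z \<noteq> 0"
    and w: "2 * cmod w \<le> r" "F w \<noteq> 0"
  shows "ln (cmod (F w)) \<le> 3 * proximity r F"
proof (rule Blaschke_logarithm[OF F r nz])
  fix S n G h R
  assume *: "r < R" "h holomorphic_on ball 0 R"
    "\<And>z. cmod z = r \<Longrightarrow> ln (cmod (F z)) = Re (h z)"
    "\<And>z. cmod z < r \<Longrightarrow> F z \<noteq> 0 \<Longrightarrow> ln (cmod (F z)) \<le> Re (h z)"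
  have "ln (cmod (F w)) \<le> Re (h w)"
    using w r * by simp
  also have "\<dots> \<le> 3 * circle_mean r (\<lambda>z. max 0 (ln (cmod (F z))))"
    using w r * nz by (intro Poisson_le_circle_mean continuous_on_max continuous_on_const continuous_on_ln_cmod F) auto
  also have "circle_mean r (\<lambda>z. max 0 (ln (cmod (F z)))) = circle_mean r (\<lambda>z. log_plus (cmod (F z)))"
    using nz r by (intro circle_mean_cong) (auto simp: log_plus_eq)
  finally show ?thesis
    by (simp add: proximity_eq_circle_mean)
qed

lemma circle_mean_ln_cmod:
  assumes F: "F holomorphic_on UNIV" and r: "0 < r" and nz: "\<And>z. cmod z = r \<Longrightarrow> F z \<noteq> 0"
  shows "circle_mean r (\<lambda>z. ln (cmod (F z))) = proximity r F - proximity r (\<lambda>z. 1 / F z)"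
proof -
  define u where "u = (\<lambda>z. ln (cmod (F z)))"
  have u: "continuous_on (sphere 0 r) u"
    unfolding u_def by (rule continuous_on_ln_cmod[OF F nz])
  have 1: "proximity r F = circle_mean r (\<lambda>z. max 0 (u z))"
    unfolding proximity_eq_circle_mean
    using nz r by (intro circle_mean_cong) (auto simp: log_plus_eq u_def)
  have 2: "proximity r (\<lambda>z. 1 / F z) = circle_mean r (\<lambda>z. max 0 (- u z))"
    unfolding proximity_eq_circle_mean
    using nz r by (intro circle_mean_cong) (auto simp: log_plus_eq u_def norm_divide ln_div)
  have "circle_mean r (\<lambda>z. max 0 (u z)) = circle_mean r (\<lambda>z. u z + max 0 (- u z))"
    using r by (intro circle_mean_cong) auto
  also have "\<dots> = circle_mean r u + circle_mean r (\<lambda>z. max 0 (- u z))"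
    using u r by (intro circle_mean_add continuous_intros) auto
  finally show ?thesis
    using 1 2 by (simp add: u_def)
qed

lemma characteristic_entire:
  assumes F: "F holomorphic_on UNIV"
  shows "characteristic r F = proximity r F"
proof -
  have "\<not> is_pole F z" for z
    using F not_is_pole_holomorphic[of UNIV z F] by auto
  then show ?thesis
    by (simp add: characteristic_def integrated_counting_def pole_count_def)
qed

lemma proximity_nonneg: "0 \<le> proximity r g"
proof -
  have "0 \<le> integral {0..2 * pi} (\<lambda>t. log_plus (cmod (g (of_real r * cis t))))"
  proof (cases "(\<lambda>t. log_plus (cmod (g (of_real r * cis t)))) integrable_on {0..2 * pi}")
    case True
    then show ?thesis
      by (rule integral_nonneg) (auto simp: log_plus_def)
  qed (simp add: not_integrable_integral)
  then show ?thesis by (simp add: proximity_def)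
qed

section \<open>Local distortion of an entire function\<close>

text \<open>
  With \<open>A = B - Re (h b)\<close> and \<open>H = h - h b\<close>, rescaled to the unit disc, \<open>Re H < A\<close> means that
  \<open>H / (2 A - H)\<close> maps the unit disc into itself. The Schwarz lemma then gives \<open>|H| \<le> 4 A\<close> on
  two thirds of the disc, and Cauchy's estimate on discs of radius \<open>R / 6\<close> bounds the derivative on
  one half of it.
\<close>
lemma Borel_Caratheodory_deriv:
  assumes h: "h holomorphic_on ball b R" and R: "0 < R"
    and B: "\<And>z. z \<in> ball b R \<Longrightarrow> Re (h z) < B" and z: "z \<in> cball b (R / 2)"
  shows "cmod (deriv h z) \<le> 24 * (B - Re (h b)) / R"
proof -
  define A where "A = B - Re (h b)"
  have A: "A > 0" using B[of b] R by (simp add: A_def)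
  define H where "H = (\<lambda>\<zeta>. h (b + of_real R * \<zeta>) - h b)"
  have in_ball: "b + of_real R * \<zeta> \<in> ball b R" if "cmod \<zeta> < 1" for \<zeta>
    using that R by (simp add: dist_norm norm_mult)
  have ReH: "Re (H \<zeta>) < A" if "cmod \<zeta> < 1" for \<zeta>
    using B[OF in_ball[OF that]] by (simp add: H_def A_def)
  have H_hol: "H holomorphic_on ball 0 1"
    unfolding H_def
  proof (intro holomorphic_intros)
    have "h \<circ> (\<lambda>\<zeta>. b + of_real R * \<zeta>) holomorphic_on ball 0 1"
      by (rule holomorphic_on_compose_gen[OF _ h]) (use in_ball in \<open>auto intro!: holomorphic_intros\<close>)
    then show "(\<lambda>\<zeta>. h (b + of_real R * \<zeta>)) holomorphic_on ball 0 1"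
      by (simp add: o_def)
  qed
  have den: "2 * of_real A - H \<zeta> \<noteq> 0" if "cmod \<zeta> < 1" for \<zeta>
    using ReH[OF that] A by (auto simp: complex_eq_iff)
  have less: "cmod (H \<zeta>) < cmod (2 * of_real A - H \<zeta>)" if "cmod \<zeta> < 1" for \<zeta>
  proof -
    have "(cmod (2 * of_real A - H \<zeta>))\<^sup>2 - (cmod (H \<zeta>))\<^sup>2 = 4 * (A * (A - Re (H \<zeta>)))"
      unfolding cmod_power2 by (simp add: power2_eq_square algebra_simps)
    moreover have "A * (A - Re (H \<zeta>)) > 0" using A ReH[OF that] by simp
    ultimately have "(cmod (H \<zeta>))\<^sup>2 < (cmod (2 * of_real A - H \<zeta>))\<^sup>2" by linarith
    then show ?thesis by (rule power2_less_imp_less) simp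
  qed
  have H_le: "cmod (H \<zeta>) \<le> 4 * A" if \<zeta>: "cmod \<zeta> \<le> 2 / 3" for \<zeta>
  proof -
    have \<zeta>1: "cmod \<zeta> < 1" using \<zeta> by simp
    have "cmod (H \<zeta> / (2 * of_real A - H \<zeta>)) \<le> cmod \<zeta>"
    proof (rule Schwarz_Lemma(1)[where f = "\<lambda>\<zeta>. H \<zeta> / (2 * of_real A - H \<zeta>)"])
      show "(\<lambda>\<zeta>. H \<zeta> / (2 * complex_of_real A - H \<zeta>)) holomorphic_on ball 0 1"
        using den by (intro holomorphic_intros H_hol) auto
      show "cmod (H z / (2 * complex_of_real A - H z)) < 1" if "cmod z < 1" for z
        using less[OF that] den[OF that] by (simp add: norm_divide)
    qed (use \<zeta>1 in \<open>auto simp: H_def\<close>)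
    hence "cmod (H \<zeta>) \<le> cmod \<zeta> * cmod (2 * of_real A - H \<zeta>)"
      using den[OF \<zeta>1] by (simp add: norm_divide divide_simps)
    also have "\<dots> \<le> 2 / 3 * (2 * A + cmod (H \<zeta>))"
    proof (rule mult_mono)
      show "cmod (2 * of_real A - H \<zeta>) \<le> 2 * A + cmod (H \<zeta>)"
        using norm_triangle_ineq4[of "2 * of_real A" "H \<zeta>"] A by (simp add: norm_mult)
    qed (use \<zeta> in auto)
    finally show ?thesis by simp
  qed
  have near: "cmod (h x - h b) \<le> 4 * A" if "cmod (x - b) \<le> 2 * R / 3" for x
  proof -
    have "cmod (H ((x - b) / of_real R)) \<le> 4 * A"
      using that R by (intro H_le) (simp add: norm_divide divide_simps)
    then show ?thesis using R by (simp add: H_def)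
  qed
  have sub: "cball z (R / 6) \<subseteq> ball b R"
    using z R by (auto simp: dist_norm subset_iff)
       (smt (verit) norm_minus_commute norm_triangle_ineq4 diff_add_cancel add_diff_eq norm_diff_triangle_le)
  have "cmod ((deriv ^^ 1) (\<lambda>x. h x - h b) z) \<le> fact 1 * (4 * A) / (R / 6) ^ 1"
  proof (rule Cauchy_inequality)
    show "(\<lambda>x. h x - h b) holomorphic_on ball z (R / 6)"
      using sub by (intro holomorphic_intros holomorphic_on_subset[OF h]) auto
    show "continuous_on (cball z (R / 6)) (\<lambda>x. h x - h b)"
      using sub by (intro continuous_intros holomorphic_on_imp_continuous_on holomorphic_on_subset[OF h]) auto
    fix x assume x: "cmod (z - x) = R / 6"
    have "cmod (x - b) \<le> cmod (z - b) + cmod (z - x)"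
      using norm_triangle_ineq4[of "z - b" "z - x"] by simp
    then show "cmod (h x - h b) \<le> 4 * A"
      using x z R by (intro near) (auto simp: dist_norm norm_minus_commute)
  qed (use R in auto)
  moreover have "deriv (\<lambda>x. h x - h b) z = deriv h z"
  proof -
    have "z \<in> cball z (R / 6)" using R by simp
    then have "z \<in> ball b R" using sub by blast
    then have "h field_differentiable at z"
      using h by (meson holomorphic_on_imp_differentiable_at open_ball)
    then show ?thesis by simp
  qed
  ultimately show ?thesis
    using R by (simp add: A_def field_simps)
qed

lemma one_plus_le_exp_sqrt:
  assumes "0 \<le> x"
  shows "1 + x \<le> exp (2 * sqrt x)"
proof -
  have "1 + x \<le> (1 + sqrt x)\<^sup>2"
    using assms by (simp add: power2_eq_square algebra_simps)
  also have "\<dots> \<le> (exp (sqrt x))\<^sup>2"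
    using assms by (intro power_mono exp_ge_add_one_self) auto
  also have "\<dots> = exp (2 * sqrt x)"
    by (simp add: exp_double)
  finally show ?thesis .
qed

text \<open>
  Divide \<open>F\<close> by the factors \<open>(z - a) / (b - a)\<close> for its zeros in \<open>cball b R\<close>. These have modulus at
  least \<open>2\<close> at distance \<open>3 R\<close> from \<open>b\<close>, so the maximum principle bounds both the quotient and the
  number of zeros. The quotient is free of zeros and is handled by its logarithm. Each removed factor
  changes between \<open>z\<close> and \<open>w\<close> at most by the ratio
  \<open>|w - a| / |z - a| \<le> 1 + K / |z - a| \<le> exp (2 * sqrt (K / |z - a|))\<close>. The square root makes the
  bound integrable over circles, and uniformly so in \<open>a\<close>.
\<close>
lemma entire_local_distortion:
  assumes F: "F holomorphic_on UNIV" and b: "F b \<noteq> 0" and R: "0 < R" and K: "0 \<le> K"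
    and B: "\<And>z. cmod (z - b) \<le> 3 * R \<Longrightarrow> cmod (F z) \<le> exp B"
  obtains S n where "finite S" "\<And>a. a \<in> S \<Longrightarrow> F a = 0"
    "(\<Sum>a\<in>S. real (n a)) * ln 2 \<le> B - ln (cmod (F b))"
    "\<And>z w. cmod (z - b) \<le> R / 2 \<Longrightarrow> cmod (w - b) \<le> R / 2 \<Longrightarrow> cmod (w - z) \<le> K \<Longrightarrow> F z \<noteq> 0 \<Longrightarrow>
       cmod (F w) \<le> cmod (F z) *
          exp (24 * K * (B + 1 - ln (cmod (F b))) / R + (\<Sum>a\<in>S. n a * (2 * sqrt (K / cmod (z - a)))))"
proof -
  define S where "S = {z \<in> cball b R. F z = 0}"
  have fin: "finite S"
    unfolding S_def by (rule entire_finite_zeros[OF F b])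
  obtain n G where G: "G holomorphic_on UNIV" "\<And>a. a \<in> S \<Longrightarrow> G a \<noteq> 0"
    and FG: "\<And>z. F z = (\<Prod>a\<in>S. (z - a) ^ n a) * G z"
    using entire_finite_factorization[OF F b fin] by metis
  have Sb: "b \<noteq> a" "cmod (b - a) \<le> R" "F a = 0" if "a \<in> S" for a
    using that b by (auto simp: S_def dist_norm)
  define N where "N = (\<Sum>a\<in>S. n a)"
  define G1 where "G1 = (\<lambda>z. G z * (\<Prod>a\<in>S. (b - a) ^ n a))"
  have G1_hol: "G1 holomorphic_on UNIV"
    unfolding G1_def by (intro holomorphic_intros G)
  have G1_b: "G1 b = F b"
    by (simp add: G1_def FG)
  have G1_0: "G1 z \<noteq> 0" if "z \<in> cball b R" for z
  proof (cases "F z = 0")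
    case True
    hence "z \<in> S" using that by (auto simp: S_def)
    then show ?thesis using G(2)[of z] Sb fin by (auto simp: G1_def)
  next
    case False
    then show ?thesis using FG[of z] Sb fin by (auto simp: G1_def)
  qed
  have outer: "cmod (G1 z) \<le> exp B / 2 ^ N" if z: "cmod (z - b) = 3 * R" for z
  proof -
    have "2 ^ N * cmod (G1 z) = cmod (G z) * (\<Prod>a\<in>S. (2 * cmod (b - a)) ^ n a)"
      by (simp add: G1_def norm_mult prod_norm[symmetric] norm_power N_def power_sum
            power_mult_distrib prod.distrib)
    also have "\<dots> \<le> cmod (G z) * (\<Prod>a\<in>S. cmod (z - a) ^ n a)"
    proof (intro mult_left_mono prod_mono conjI power_mono)
      fix a assume "a \<in> S"
      moreover have "cmod (z - b) \<le> cmod (z - a) + cmod (b - a)"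
        using norm_triangle_ineq4[of "z - a" "b - a"] by simp
      ultimately show "2 * cmod (b - a) \<le> cmod (z - a)"
        using Sb(2)[of a] z by linarith
    qed auto
    also have "\<dots> = cmod (F z)"
      by (simp add: FG norm_mult prod_norm[symmetric] norm_power)
    also have "\<dots> \<le> exp B"
      using z by (intro B) simp
    finally show ?thesis by (simp add: field_simps)
  qed
  have G1_le: "cmod (G1 z) \<le> exp B / 2 ^ N" if "z \<in> cball b (3 * R)" for z
  proof (rule maximum_modulus_frontier[of G1 "cball b (3 * R)"])
    show "G1 holomorphic_on interior (cball b (3 * R))" "continuous_on (closure (cball b (3 * R))) G1"
      using G1_hol by (auto intro: holomorphic_on_subset holomorphic_on_imp_continuous_on)
    show "cmod (G1 x) \<le> exp B / 2 ^ N" if "x \<in> frontier (cball b (3 * R))" for x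
      using that R by (intro outer) (simp add: dist_norm norm_minus_commute)
  qed (use that in auto)
  have "ln (cmod (F b)) \<le> ln (exp B / 2 ^ N)"
    using G1_le[of b] b R unfolding G1_b by (intro ln_mono) auto
  hence N_le: "N * ln 2 \<le> B - ln (cmod (F b))"
    by (simp add: ln_div ln_realpow)
  obtain h where h: "h holomorphic_on ball b R" "\<And>z. z \<in> ball b R \<Longrightarrow> G1 z = exp (h z)"
  proof (rule contractible_imp_holomorphic_log[of G1 "ball b R"])
    show "G1 holomorphic_on ball b R"
      by (rule holomorphic_on_subset[OF G1_hol]) simp
    show "G1 z \<noteq> 0" if "z \<in> ball b R" for z
      using that by (intro G1_0) auto
  qed (auto intro: convex_imp_contractible)
  have Re_h: "Re (h z) = ln (cmod (G1 z))" if "z \<in> ball b R" for z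
    using h(2)[OF that] by (simp add: norm_exp_eq_Re)
  \<comment> \<open>the Borel-Caratheodory bound needs a strict inequality, whence \<open>B + 1\<close>\<close>
  have Re_h_less: "Re (h z) < B + 1" if "z \<in> ball b R" for z
  proof -
    have "cmod (G1 z) \<le> exp B / 2 ^ N" using that R by (intro G1_le) auto
    also have "\<dots> \<le> exp B" by (simp add: field_simps)
    finally have "cmod (exp (h z)) \<le> exp B" using h(2)[OF that] by simp
    then show ?thesis by (simp add: norm_exp_eq_Re)
  qed
  define D where "D = 24 * (B + 1 - ln (cmod (F b))) / R"
  have lip: "cmod (h w - h z) \<le> D * cmod (w - z)"
    if "z \<in> cball b (R / 2)" "w \<in> cball b (R / 2)" for z w
  proof (rule field_differentiable_bound[OF convex_cball])
    fix x assume x: "x \<in> cball b (R / 2)"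
    hence "x \<in> ball b R" using R by auto
    then show "(h has_field_derivative deriv h x) (at x within cball b (R / 2))"
      using h(1) holomorphic_derivI open_ball by blast
    show "cmod (deriv h x) \<le> D"
      using Borel_Caratheodory_deriv[OF h(1) R Re_h_less x] R by (simp add: D_def Re_h G1_b)
  qed (use that in auto)
  show ?thesis
  proof
    show "finite S" "\<And>a. a \<in> S \<Longrightarrow> F a = 0" using fin Sb by auto
    show "(\<Sum>a\<in>S. real (n a)) * ln 2 \<le> B - ln (cmod (F b))"
      using N_le by (simp add: N_def)
    fix z w assume z: "cmod (z - b) \<le> R / 2" and w: "cmod (w - b) \<le> R / 2"
      and zw: "cmod (w - z) \<le> K" and Fz: "F z \<noteq> 0"
    have zb: "z \<in> cball b (R / 2)" "w \<in> cball b (R / 2)"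
      using z w by (auto simp: dist_norm norm_minus_commute)
    hence zb': "z \<in> ball b R" "w \<in> ball b R" using R by auto
    have D0: "0 \<le> D"
      using Re_h_less[of b] R by (simp add: D_def Re_h G1_b)
    have modF: "cmod (F x) * (\<Prod>a\<in>S. cmod (b - a) ^ n a) = (\<Prod>a\<in>S. cmod (x - a) ^ n a) * exp (Re (h x))"
      if "x \<in> ball b R" for x
      using h(2)[OF that, symmetric]
      by (simp add: FG G1_def norm_mult prod_norm[symmetric] norm_power norm_exp_eq_Re[symmetric])
    define e where "e = (\<lambda>a. 2 * sqrt (K / cmod (z - a)))"
    have za: "cmod (w - a) \<le> cmod (z - a) * exp (e a)" if "a \<in> S" for a
    proof -
      have *: "z \<noteq> a" using Fz Sb that by auto
      have "cmod (w - a) \<le> cmod (z - a) + K"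
        using norm_triangle_ineq[of "w - z" "z - a"] zw by simp
      also have "\<dots> = cmod (z - a) * (1 + K / cmod (z - a))"
        using * by (simp add: field_simps)
      also have "\<dots> \<le> cmod (z - a) * exp (e a)"
        unfolding e_def using K by (intro mult_left_mono one_plus_le_exp_sqrt) auto
      finally show ?thesis .
    qed
    have "(\<Prod>a\<in>S. cmod (w - a) ^ n a) \<le> (\<Prod>a\<in>S. (cmod (z - a) * exp (e a)) ^ n a)"
      using za by (intro prod_mono conjI power_mono) auto
    also have "\<dots> = (\<Prod>a\<in>S. cmod (z - a) ^ n a) * exp (\<Sum>a\<in>S. n a * e a)"
      using fin by (simp add: power_mult_distrib prod.distrib exp_sum exp_of_nat_mult)
    finally have P: "(\<Prod>a\<in>S. cmod (w - a) ^ n a) \<le> (\<Prod>a\<in>S. cmod (z - a) ^ n a) * exp (\<Sum>a\<in>S. n a * e a)" .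
    have "Re (h w) - Re (h z) \<le> cmod (h w - h z)"
      using complex_Re_le_cmod[of "h w - h z"] by simp
    also have "\<dots> \<le> D * K"
      using lip[OF zb] mult_left_mono[OF zw D0] by linarith
    finally have E: "exp (Re (h w)) \<le> exp (Re (h z)) * exp (D * K)"
      by (simp flip: exp_add)
    have "cmod (F w) * (\<Prod>a\<in>S. cmod (b - a) ^ n a)
        \<le> ((\<Prod>a\<in>S. cmod (z - a) ^ n a) * exp (\<Sum>a\<in>S. n a * e a)) * (exp (Re (h z)) * exp (D * K))"
      unfolding modF[OF zb'(2)] using P E by (intro mult_mono) (auto intro!: prod_nonneg mult_nonneg_nonneg)
    also have "\<dots> = cmod (F z) * exp (D * K + (\<Sum>a\<in>S. n a * e a)) * (\<Prod>a\<in>S. cmod (b - a) ^ n a)"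
      using modF[OF zb'(1)] by (simp add: exp_add mult_ac)
    finally have "cmod (F w) \<le> cmod (F z) * exp (D * K + (\<Sum>a\<in>S. n a * e a))"
      by (rule mult_right_le_imp_le) (use Sb in \<open>auto intro!: prod_pos\<close>)
    then show "cmod (F w) \<le> cmod (F z) *
          exp (24 * K * (B + 1 - ln (cmod (F b))) / R + (\<Sum>a\<in>S. n a * (2 * sqrt (K / cmod (z - a)))))"
      by (simp add: D_def e_def mult_ac)
  qed
qed

text \<open>
  Up to the factor \<open>r\<close>, the distance to \<open>a\<close> is at least \<open>|u|\<close> for the function \<open>u z = 1 - \<beta> * z\<close>, which
  has positive real part in a disc. There \<open>1 / csqrt u\<close> is holomorphic with values in the sector
  \<open>|arg| \<le> pi / 4\<close>. So its modulus is at most \<open>sqrt 2\<close> times its real part, whose mean is its value \<open>1\<close>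
  at the origin.
\<close>
lemma circle_mean_inverse_sqrt_aux:
  assumes r: "0 < r" and \<beta>: "cmod \<beta> * r < 1" and ge: "\<And>z. cmod z = r \<Longrightarrow> r * cmod (1 - \<beta> * z) \<le> cmod (z - a)"
    and ne: "cmod a \<noteq> r"
  shows "circle_mean r (\<lambda>z. sqrt (1 / cmod (z - a))) \<le> sqrt (2 / r)"
proof -
  define R where "R = (if \<beta> = 0 then 2 * r else 1 / cmod \<beta>)"
  have R: "r < R" using r \<beta> by (auto simp: R_def field_simps)
  have small: "cmod (\<beta> * z) < 1" if "cmod z < R" for z
    using that r by (auto simp: R_def norm_mult field_simps split: if_splits)
  have Re_pos: "0 < Re (1 - \<beta> * z)" if "cmod z < R" for z
    using small[OF that] complex_Re_le_cmod[of "\<beta> * z"] by simp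
  define \<phi> where "\<phi> = (\<lambda>z. 1 / csqrt (1 - \<beta> * z))"
  have not_nonpos: "1 - \<beta> * z \<notin> \<real>\<^sub>\<le>\<^sub>0" "1 - \<beta> * z \<noteq> 0" if "z \<in> ball 0 R" for z
    using Re_pos[of z] that by (auto simp: complex_nonpos_Reals_iff complex_eq_iff)
  have \<phi>: "\<phi> holomorphic_on ball 0 R"
    unfolding \<phi>_def
    by (intro holomorphic_intros) (use not_nonpos in auto)
  have "circle_mean r (\<lambda>z. sqrt (1 / cmod (z - a))) \<le> circle_mean r (\<lambda>z. sqrt (2 / r) * Re (\<phi> z))"
  proof (rule circle_mean_mono)
    show "continuous_on (sphere 0 r) (\<lambda>z. sqrt (1 / cmod (z - a)))"
      using ne by (intro continuous_intros) auto
    show "continuous_on (sphere 0 r) (\<lambda>z. sqrt (2 / r) * Re (\<phi> z))"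
      using R by (intro continuous_intros holomorphic_on_imp_continuous_on holomorphic_on_subset[OF \<phi>]) auto
    fix z assume z: "cmod z = r"
    define u where "u = 1 - \<beta> * z"
    define s where "s = csqrt u"
    have u: "0 < Re u" using Re_pos[of z] z R by (simp add: u_def)
    hence u0: "0 < cmod u" by auto
    have s2: "(cmod s)\<^sup>2 = cmod u"
      by (simp add: s_def)
    have "Re s = sqrt ((cmod u + Re u) / 2)"
      by (simp add: s_def)
    also have "\<dots> \<ge> sqrt (cmod u / 2)"
      using u by simp
    finally have Re_s: "sqrt (cmod u / 2) \<le> Re s" .
    have "Re (\<phi> z) = Re s / cmod u"
    proof -
      have "Re (1 / s) = Re s / (cmod s)\<^sup>2"
        by (simp add: Re_divide cmod_power2)
      moreover have "\<phi> z = 1 / s"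
        by (simp add: \<phi>_def s_def u_def)
      ultimately show ?thesis by (simp only: s2)
    qed
    also have "\<dots> \<ge> sqrt (cmod u / 2) / cmod u"
      using Re_s by (intro divide_right_mono) auto
    finally have 1: "sqrt (cmod u / 2) / cmod u \<le> Re (\<phi> z)" .
    have "z \<noteq> a" using z ne by auto
    hence "sqrt (1 / cmod (z - a)) \<le> sqrt (1 / (r * cmod u))"
      using ge[OF z] r u0 unfolding u_def by (intro real_sqrt_le_mono divide_left_mono mult_pos_pos) auto
    also have "\<dots> = sqrt (2 / r) * (sqrt (cmod u / 2) / cmod u)"
    proof -
      have "sqrt (1 / (r * cmod u)) = sqrt (2 / r * (cmod u / 2) / (cmod u)\<^sup>2)"
        using u0 r by (simp add: power2_eq_square)
      also have "\<dots> = sqrt (2 / r) * (sqrt (cmod u / 2) / cmod u)"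
        using u0 by (simp only: real_sqrt_mult real_sqrt_divide real_sqrt_abs) simp
      finally show ?thesis .
    qed
    also have "\<dots> \<le> sqrt (2 / r) * Re (\<phi> z)"
      using 1 r by (intro mult_left_mono) auto
    finally show "sqrt (1 / cmod (z - a)) \<le> sqrt (2 / r) * Re (\<phi> z)" .
  qed (use r in auto)
  also have "\<dots> = sqrt (2 / r)"
    using circle_mean_Re_holomorphic[OF \<phi> r R] by (simp add: circle_mean_cmult \<phi>_def)
  finally show ?thesis .
qed

text \<open>
  For \<open>a\<close> inside the circle, \<open>z - a\<close> is first replaced by the conjugate Blaschke factor, which has the
  same modulus on the circle and no zero in the disc.
\<close>
lemma circle_mean_inverse_sqrt:
  assumes r: "0 < r" and ne: "cmod a \<noteq> r"
  shows "circle_mean r (\<lambda>z. sqrt (1 / cmod (z - a))) \<le> sqrt (2 / r)"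
proof (cases "cmod a < r")
  case True
  show ?thesis
  proof (rule circle_mean_inverse_sqrt_aux[where \<beta> = "cnj a / of_real (r\<^sup>2)"])
    show "cmod (cnj a / of_real (r\<^sup>2)) * r < 1"
      using True r by (simp add: norm_divide norm_mult power2_eq_square)
    fix z assume z: "cmod z = r"
    have "(cmod (of_real (r\<^sup>2) - cnj a * z))\<^sup>2 = (r * cmod (z - a))\<^sup>2"
      unfolding Blaschke_identity using z by simp
    hence eq: "cmod (of_real (r\<^sup>2) - cnj a * z) = r * cmod (z - a)"
      by (rule power2_eq_imp_eq) (use r in auto)
    have "1 - cnj a / of_real (r\<^sup>2) * z = (of_real (r\<^sup>2) - cnj a * z) / of_real (r\<^sup>2)"
      using r by (simp add: field_simps)
    hence "r * cmod (1 - cnj a / of_real (r\<^sup>2) * z) = r * (r * cmod (z - a) / r\<^sup>2)"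
      by (simp only: norm_divide eq norm_of_real) simp
    then show "r * cmod (1 - cnj a / of_real (r\<^sup>2) * z) \<le> cmod (z - a)"
      using r by (simp add: power2_eq_square)
  qed (use r ne in auto)
next
  case False
  hence a: "r < cmod a" "a \<noteq> 0" using ne r by auto
  show ?thesis
  proof (rule circle_mean_inverse_sqrt_aux[where \<beta> = "1 / a"])
    show "cmod (1 / a) * r < 1"
      using a by (simp add: norm_divide)
    fix z
    have "z - a = - a * (1 - 1 / a * z)"
      using a by (simp add: field_simps)
    hence "cmod (z - a) = cmod a * cmod (1 - 1 / a * z)"
      by (simp only: norm_mult norm_minus_cancel)
    then show "r * cmod (1 - 1 / a * z) \<le> cmod (z - a)"
      using a by (simp add: mult_right_mono)
  qed (use r ne in auto)
qed

section \<open>Distortion on circles under finite order\<close>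

text \<open>
  The function \<open>E\<close> majorizes the increase of \<open>ln |F|\<close> within distance \<open>K\<close>. It is required to be continuous
  so that the means of sums and of larger functions can be computed termwise and compared.
\<close>
definition circle_distortion_le :: "(complex \<Rightarrow> complex) \<Rightarrow> real \<Rightarrow> real \<Rightarrow> real \<Rightarrow> bool" where
  "circle_distortion_le F K r M \<longleftrightarrow>
    (\<exists>E. continuous_on (sphere 0 r) E \<and> (\<forall>z. cmod z = r \<longrightarrow> 0 \<le> E z) \<and> circle_mean r E \<le> M \<and>
      (\<forall>z w. cmod z = r \<longrightarrow> cmod (w - z) \<le> K \<longrightarrow> cmod (F w) \<le> cmod (F z) * exp (E z)))"

lemma entire_mean_distortion:
  assumes F: "F holomorphic_on UNIV" and b: "F b \<noteq> 0" and K: "0 \<le> K" and A: "0 \<le> A"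
    and growth: "\<And>r z. r0 \<le> r \<Longrightarrow> cmod z \<le> r \<Longrightarrow> cmod (F z) \<le> exp (A * r powr \<sigma>)"
  obtains C r1 where "\<forall>r\<ge>r1. (\<forall>z. cmod z = r \<longrightarrow> F z \<noteq> 0) \<longrightarrow>
    circle_distortion_le F K r (C * (1 + r powr (\<sigma> - 1 / 2)))"
proof -
  define L where "L = ln (cmod (F b))"
  define C where "C = (6 * K + 2 * sqrt K * sqrt 2 / ln 2) * (A * 13 powr \<sigma> + 1 + \<bar>L\<bar>)"
  define r1 where "r1 = max 1 (max r0 (cmod b + K))"
  show ?thesis
  proof (rule that[of r1 C], intro allI impI)
    fix r assume "r1 \<le> r" and nz': "\<forall>z. cmod z = r \<longrightarrow> F z \<noteq> 0"
    have nz: "F z \<noteq> 0" if "cmod z = r" for z using nz' that by blast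
    have r: "1 \<le> r" "r0 \<le> r" "cmod b + K \<le> r" using \<open>r1 \<le> r\<close> by (auto simp: r1_def)
    \<comment> \<open>a disc of radius \<open>3 * (4 * r)\<close> around \<open>b\<close> lies in the disc of radius \<open>13 * r\<close> around \<open>0\<close>\<close>
    define B where "B = A * (13 * r) powr \<sigma>"
    have B: "cmod (F z) \<le> exp B" if "cmod (z - b) \<le> 3 * (4 * r)" for z
      unfolding B_def
    proof (rule growth)
      show "cmod z \<le> 13 * r"
        using norm_triangle_ineq[of "z - b" b] that r K by simp
    qed (use r in auto)
    have "0 < 4 * r" using r by simp
    obtain S n where fin: "finite S" and S: "\<And>a. a \<in> S \<Longrightarrow> F a = 0"
      and N: "(\<Sum>a\<in>S. real (n a)) * ln 2 \<le> B - L"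
      and dist: "\<And>z w. cmod (z - b) \<le> 4 * r / 2 \<Longrightarrow> cmod (w - b) \<le> 4 * r / 2 \<Longrightarrow> cmod (w - z) \<le> K \<Longrightarrow> F z \<noteq> 0 \<Longrightarrow>
       cmod (F w) \<le> cmod (F z) *
          exp (24 * K * (B + 1 - L) / (4 * r) + (\<Sum>a\<in>S. n a * (2 * sqrt (K / cmod (z - a)))))"
      using entire_local_distortion[OF F b \<open>0 < 4 * r\<close> K B] unfolding L_def by blast
    define D where "D = B + 1 - L"
    define N where "N = (\<Sum>a\<in>S. real (n a))"
    have N0: "0 \<le> N" unfolding N_def by (intro sum_nonneg) auto
    have N_le: "N * ln 2 \<le> D" using N by (simp add: N_def D_def)
    hence D0: "0 \<le> D" using N0 by (smt (verit) ln_gt_zero mult_nonneg_nonneg)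
    define E where "E = (\<lambda>z. 6 * K * D / r + (\<Sum>a\<in>S. n a * (2 * sqrt (K / cmod (z - a)))))"
    have Sr: "cmod a \<noteq> r" if "a \<in> S" for a using S[OF that] nz by auto
    have cont: "continuous_on (sphere 0 r) (\<lambda>z. n a * (2 * sqrt (K / cmod (z - a))))" if "a \<in> S" for a
      using Sr[OF that] by (intro continuous_intros) auto
    have mean: "circle_mean r (\<lambda>z. n a * (2 * sqrt (K / cmod (z - a)))) \<le> n a * (2 * sqrt K * sqrt (2 / r))"
      if "a \<in> S" for a
    proof -
      have "circle_mean r (\<lambda>z. n a * (2 * sqrt (K / cmod (z - a))))
          = circle_mean r (\<lambda>z. (n a * (2 * sqrt K)) * sqrt (1 / cmod (z - a)))"
        by (simp add: real_sqrt_divide)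
      also have "\<dots> = (n a * (2 * sqrt K)) * circle_mean r (\<lambda>z. sqrt (1 / cmod (z - a)))"
        by (rule circle_mean_cmult)
      also have "\<dots> \<le> (n a * (2 * sqrt K)) * sqrt (2 / r)"
        using r K Sr[OF that] by (intro mult_left_mono circle_mean_inverse_sqrt) auto
      finally show ?thesis by (simp add: mult_ac)
    qed
    have rp: "r powr (- (1/2)) = 1 / sqrt r"
    proof -
      have "r powr (- (1/2)) = inverse (r powr (1/2))"
        using powr_minus[of r "1/2"] by simp
      also have "r powr (1/2) = sqrt r"
        using r by (simp add: powr_half_sqrt)
      finally show ?thesis
        by (simp add: inverse_eq_divide)
    qed
    have r_inv: "1 / r \<le> r powr (- (1/2))"
    proof -
      have "sqrt r \<le> r" using r by (simp add: real_le_lsqrt power2_eq_square)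
      then show ?thesis using r unfolding rp by (intro divide_left_mono) auto
    qed
    have "circle_mean r E = 6 * K * D / r + (\<Sum>a\<in>S. circle_mean r (\<lambda>z. n a * (2 * sqrt (K / cmod (z - a)))))"
    proof -
      have "circle_mean r E = circle_mean r (\<lambda>_. 6 * K * D / r)
          + circle_mean r (\<lambda>z. \<Sum>a\<in>S. n a * (2 * sqrt (K / cmod (z - a))))"
        unfolding E_def using r
        by (intro circle_mean_add continuous_on_sum cont continuous_on_const) auto
      then show ?thesis
        using circle_mean_sum[OF fin cont] r by simp
    qed
    also have "\<dots> \<le> 6 * K * D / r + (\<Sum>a\<in>S. n a * (2 * sqrt K * sqrt (2 / r)))"
      using mean by (intro add_mono sum_mono) auto
    also have "(\<Sum>a\<in>S. n a * (2 * sqrt K * sqrt (2 / r))) = N * (2 * sqrt K * sqrt 2 * r powr (- (1/2)))"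
      by (simp add: N_def sum_distrib_right sum_divide_distrib rp real_sqrt_divide)
    also have "6 * K * D / r = 6 * K * D * (1 / r)" by simp
    also have "6 * K * D * (1 / r) + N * (2 * sqrt K * sqrt 2 * r powr (- (1/2)))
        \<le> 6 * K * D * r powr (- (1/2)) + (D / ln 2) * (2 * sqrt K * sqrt 2 * r powr (- (1/2)))"
    proof (intro add_mono mult_left_mono mult_right_mono r_inv)
      show "N \<le> D / ln 2" using N_le by (simp add: field_simps)
    qed (use K D0 in auto)
    also have "\<dots> = (6 * K + 2 * sqrt K * sqrt 2 / ln 2) * (D * r powr (- (1/2)))"
      by (simp add: algebra_simps)
    also have "\<dots> \<le> (6 * K + 2 * sqrt K * sqrt 2 / ln 2) * ((A * 13 powr \<sigma> + 1 + \<bar>L\<bar>) * (1 + r powr (\<sigma> - 1/2)))"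
    proof (intro mult_left_mono)
      have p1: "r powr (- (1/2)) \<le> 1" using r by (simp add: rp)
      have "D * r powr (- (1/2)) \<le> (B + (1 + \<bar>L\<bar>)) * r powr (- (1/2))"
        by (intro mult_right_mono) (auto simp: D_def)
      also have "\<dots> = A * 13 powr \<sigma> * r powr (\<sigma> - 1/2) + (1 + \<bar>L\<bar>) * r powr (- (1/2))"
      proof -
        have "r powr (\<sigma> - 1/2) = r powr \<sigma> * r powr (- (1/2))"
          using powr_add[of r \<sigma> "- (1/2)"] by simp
        then show ?thesis using r by (simp add: B_def powr_mult algebra_simps)
      qed
      also have "\<dots> \<le> A * 13 powr \<sigma> * (1 + r powr (\<sigma> - 1/2)) + (1 + \<bar>L\<bar>) * (1 + r powr (\<sigma> - 1/2))"
        using A p1 by (intro add_mono mult_left_mono) (auto intro: order_trans[OF p1])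
      finally show "D * r powr (- (1/2)) \<le> (A * 13 powr \<sigma> + 1 + \<bar>L\<bar>) * (1 + r powr (\<sigma> - 1/2))"
        by (simp add: algebra_simps)
    qed (use K in auto)
    finally have m: "circle_mean r E \<le> C * (1 + r powr (\<sigma> - 1/2))"
      by (simp add: C_def mult.assoc)
    show "circle_distortion_le F K r (C * (1 + r powr (\<sigma> - 1 / 2)))"
      unfolding circle_distortion_le_def
    proof (intro exI[of _ E] conjI m allI impI)
      show "continuous_on (sphere 0 r) E"
        unfolding E_def by (intro continuous_on_add continuous_on_sum cont continuous_on_const)
      show "0 \<le> E z" for z
        unfolding E_def using K D0 r by (intro add_nonneg_nonneg sum_nonneg) auto
      fix z w assume z: "cmod z = r" and w: "cmod (w - z) \<le> K"
      have "cmod (z - b) \<le> 4 * r / 2"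
        using norm_triangle_ineq4[of z b] z r K by simp
      moreover have "cmod (w - b) \<le> 4 * r / 2"
        using norm_triangle_ineq[of "w - z" "z - b"] norm_triangle_ineq4[of z b] z w r by simp
      ultimately have "cmod (F w) \<le> cmod (F z) *
          exp (24 * K * (B + 1 - L) / (4 * r) + (\<Sum>a\<in>S. n a * (2 * sqrt (K / cmod (z - a)))))"
        using w nz[OF z] by (intro dist) auto
      also have "24 * K * (B + 1 - L) / (4 * r) = 6 * K * D / r"
        by (simp add: D_def)
      finally show "cmod (F w) \<le> cmod (F z) * exp (E z)"
        by (simp add: E_def)
    qed
  qed
qed

text \<open>
  The order bounds the characteristic on all large circles. Given \<open>r\<close>, use \<open>ln_cmod_le_proximity\<close> on a
  circle without zeros and with radius between \<open>2 * r\<close> and \<open>3 * r\<close>.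
\<close>
lemma growth_of_finite_order:
  assumes f: "f holomorphic_on UNIV" and b: "f b \<noteq> 0" and ord: "growth_order f < ereal \<sigma>"
  obtains A r0 where "0 \<le> A" "\<And>r z. r0 \<le> r \<Longrightarrow> cmod z \<le> r \<Longrightarrow> cmod (f z) \<le> exp (A * r powr \<sigma>)"
proof -
  have "\<forall>\<^sub>F r in at_top. ereal (ln (characteristic r f) / ln r) < ereal \<sigma>"
    using ord unfolding growth_order_def by (rule Limsup_lessD)
  then obtain r1 where r1: "\<And>r. r1 \<le> r \<Longrightarrow> ln (characteristic r f) / ln r < \<sigma>"
    by (auto simp: eventually_at_top_linorder)
  have T: "proximity r f \<le> r powr \<sigma>" if "max r1 2 \<le> r" for r
  proof (cases "proximity r f = 0")
    case False
    hence pos: "0 < proximity r f" using proximity_nonneg[of r f] by linarith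
    have "ln (proximity r f) < \<sigma> * ln r"
      using r1[of r] that by (simp add: characteristic_entire[OF f] divide_simps)
    hence "exp (ln (proximity r f)) \<le> exp (\<sigma> * ln r)" by simp
    then show ?thesis using pos that by (simp add: powr_def)
  qed auto
  define A where "A = 3 * 3 powr \<bar>\<sigma>\<bar>"
  show ?thesis
  proof (rule that[of A "max r1 2"])
    show "0 \<le> A" by (simp add: A_def)
    fix r z assume r: "max r1 2 \<le> r" and z: "cmod z \<le> r"
    have "2 * r < 3 * r" using r by simp
    from circle_avoiding_countable[OF entire_countable_zeros[OF f b] this]
    obtain R where R: "2 * r < R" "R < 3 * r" "\<And>z. cmod z = R \<Longrightarrow> f z \<noteq> 0" by auto
    show "cmod (f z) \<le> exp (A * r powr \<sigma>)"
    proof (cases "f z = 0")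
      case False
      have "ln (cmod (f z)) \<le> 3 * proximity R f"
        by (rule ln_cmod_le_proximity[OF f]) (use R r z False in auto)
      also have "\<dots> \<le> 3 * R powr \<sigma>"
        using T[of R] r R by simp
      also have "R powr \<sigma> = (R / r) powr \<sigma> * r powr \<sigma>"
        using r R by (simp flip: powr_mult)
      also have "3 * ((R / r) powr \<sigma> * r powr \<sigma>) \<le> A * r powr \<sigma>"
      proof -
        have "(R / r) powr \<sigma> \<le> (R / r) powr \<bar>\<sigma>\<bar>"
          using r R by (intro powr_mono) (auto simp: field_simps)
        also have "\<dots> \<le> 3 powr \<bar>\<sigma>\<bar>"
          using r R by (intro powr_mono2) (auto simp: field_simps)
        finally show ?thesis by (simp add: A_def mult_right_mono)
      qed
      finally have "exp (ln (cmod (f z))) \<le> exp (A * r powr \<sigma>)" by simp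
      then show ?thesis using False by simp
    qed simp
  qed
qed

text \<open>
  By Liouville's theorem \<open>|f|\<close> takes arbitrarily large values, and these force the proximity function to
  be large on all larger circles without zeros.
\<close>
lemma proximity_unbounded:
  assumes f: "f holomorphic_on UNIV" and nc: "\<not> f constant_on UNIV"
  obtains r0 where "0 < r0" "\<And>r. r0 \<le> r \<Longrightarrow> (\<And>z. cmod z = r \<Longrightarrow> f z \<noteq> 0) \<Longrightarrow> M \<le> proximity r f"
proof -
  have "\<not> bounded (range f)"
    using Liouville_theorem[OF f] nc by (auto simp: constant_on_def)
  then obtain w where w: "exp (3 * M) < cmod (f w)"
    unfolding bounded_iff by (metis not_le rangeE)
  hence fw: "f w \<noteq> 0" by auto
  have "3 * M < ln (cmod (f w))"
  proof -
    have "ln (exp (3 * M)) < ln (cmod (f w))"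
      using w fw by (subst ln_less_cancel_iff) auto
    then show ?thesis by simp
  qed
  show ?thesis
  proof (rule that[of "max 1 (2 * cmod w)"])
    fix r assume r: "max 1 (2 * cmod w) \<le> r" and nz: "\<And>z. cmod z = r \<Longrightarrow> f z \<noteq> 0"
    have "ln (cmod (f w)) \<le> 3 * proximity r f"
      using r by (intro ln_cmod_le_proximity[OF f _ nz _ fw]) auto
    then show "M \<le> proximity r f"
      using \<open>3 * M < ln (cmod (f w))\<close> by simp
  qed simp
qed

section \<open>Counting separated pairs\<close>

lemma has_integral_inverse_from:
  fixes \<rho> :: real
  assumes "0 < \<rho>" "\<rho> \<le> r"
  shows "((\<lambda>t. if \<rho> \<le> t then k / t else 0) has_integral k * ln (r / \<rho>)) {0..r}"
proof -
  have "((\<lambda>t. k / t) has_integral (k * ln r - k * ln \<rho>)) {\<rho>..r}"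
    using assms
    by (intro fundamental_theorem_of_calculus)
       (auto intro!: derivative_eq_intros simp flip: has_real_derivative_iff_has_vector_derivative)
  hence "((\<lambda>t. if t \<in> {\<rho>..r} then k / t else 0) has_integral (k * ln r - k * ln \<rho>)) {0..r}"
    by (subst has_integral_restrict) (use assms in auto)
  moreover have "k * ln r - k * ln \<rho> = k * ln (r / \<rho>)"
    using assms by (simp add: ln_div algebra_simps)
  ultimately show ?thesis
    by (elim has_integral_eq_rhs[OF has_integral_eq, rotated]) auto
qed

text \<open>
  Integrating \<open>1 / t\<close> from \<open>|z|\<close> to \<open>r\<close> turns the counting function into a sum over the points.
\<close>
lemma integrated_counting_sum:
  assumes fin: "finite {z. cmod z \<le> r \<and> P z}" and r: "0 < r"
  shows "integrated_counting (\<lambda>t. \<Sum>z\<in>{z. cmod z \<le> t \<and> P z}. m z) r =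
    (\<Sum>z\<in>{z. cmod z \<le> r \<and> P z} - {0}. m z * ln (r / cmod z)) + real (if P 0 then m 0 else 0) * ln r"
proof -
  define S where "S = {z. cmod z \<le> r \<and> P z}"
  define n where "n = (\<lambda>t::real. \<Sum>z\<in>{z. cmod z \<le> t \<and> P z}. m z)"
  have n0: "n 0 = (if P 0 then m 0 else 0)"
  proof -
    have "{z::complex. cmod z \<le> 0 \<and> P z} = (if P 0 then {0} else {})" by auto
    then show ?thesis by (simp add: n_def)
  qed
  have n: "real (n t) - real (n 0) = (\<Sum>z\<in>S - {0}. if cmod z \<le> t then real (m z) else 0)"
    if t: "0 \<le> t" "t \<le> r" for t
  proof -
    have fin': "finite {z. cmod z \<le> t \<and> P z}"
      by (rule finite_subset[OF _ fin]) (use t in auto)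
    have "n t = (if P 0 then m 0 else 0) + (\<Sum>z\<in>{z. cmod z \<le> t \<and> P z} - {0}. m z)"
      unfolding n_def using fin' t by (auto simp: sum.remove)
    moreover have "(\<Sum>z\<in>{z. cmod z \<le> t \<and> P z} - {0}. real (m z)) = (\<Sum>z\<in>S - {0}. if cmod z \<le> t then real (m z) else 0)"
      using fin t by (intro sum.mono_neutral_cong_left) (auto simp: S_def)
    ultimately show ?thesis by (simp add: n0)
  qed
  have "((\<lambda>t. \<Sum>z\<in>S - {0}. if cmod z \<le> t then real (m z) / t else 0) has_integral
           (\<Sum>z\<in>S - {0}. m z * ln (r / cmod z))) {0..r}"
    using fin by (intro has_integral_sum has_integral_inverse_from) (auto simp: S_def)
  hence "((\<lambda>t. (real (n t) - real (n 0)) / t) has_integral (\<Sum>z\<in>S - {0}. m z * ln (r / cmod z))) {0..r}"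
    by (rule has_integral_eq[rotated])
       (simp add: n sum_divide_distrib, intro sum.cong refl, simp)
  then show ?thesis
    unfolding integrated_counting_def n_def[symmetric] S_def[symmetric]
    by (simp add: integral_unique n0)
qed

lemma integrated_counting_pair_count_nonneg:
  assumes "f holomorphic_on UNIV" "\<not> f constant_on UNIV" "1 \<le> r"
  shows "0 \<le> integrated_counting (pair_count c a f) r"
proof -
  obtain b where b: "f b - a \<noteq> 0"
    using assms(2) unfolding constant_on_def by fastforce
  have "finite {z \<in> cball 0 r. f z - a = 0}"
    using assms(1) b by (intro entire_finite_zeros[of "\<lambda>z. f z - a" b]) (auto intro!: holomorphic_intros)
  hence fin: "finite {z. cmod z \<le> r \<and> f z = a \<and> f (z + c) = a}"
    by (rule rev_finite_subset) auto
  show ?thesis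
    unfolding pair_count_def
  proof (subst integrated_counting_sum[OF fin])
    have "0 \<le> m * ln (r / cmod z)" if "cmod z \<le> r" "z \<noteq> 0" for z and m :: nat
      using that by (intro mult_nonneg_nonneg ln_ge_zero) auto
    then show "0 \<le> (\<Sum>z\<in>{z. cmod z \<le> r \<and> f z = a \<and> f (z + c) = a} - {0}. real (pair_multiplicity c f z) * ln (r / cmod z))
      + real (if f 0 = a \<and> f (0 + c) = a then pair_multiplicity c f 0 else 0) * ln r"
      using assms(3) by (intro add_nonneg_nonneg sum_nonneg mult_nonneg_nonneg) auto
  qed (use assms(3) in auto)
qed

text \<open>
  The coefficient of index \<open>n\<close> in the expansion of \<open>f (x + c) - f x\<close> at \<open>z\<close> is \<open>G z \<noteq> 0\<close>, so the two
  expansions differ at that index at the latest.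
\<close>
lemma pair_multiplicity_le:
  assumes f: "f holomorphic_on UNIV" and G: "G holomorphic_on UNIV" "G z \<noteq> 0"
    and fG: "\<And>x. f (x + c) - f x = (x - z) ^ n * G x"
  shows "pair_multiplicity c f z \<le> n"
proof -
  define F1 where "F1 = fps_expansion f z"
  define F2 where "F2 = fps_expansion f (z + c)"
  have an: "f analytic_on {x}" "G analytic_on {x}" for x
    using f G by (simp_all add: analytic_on_holomorphic) (metis open_UNIV subset_UNIV UNIV_I)+
  have 1: "(\<lambda>x. f (z + x)) has_fps_expansion F1" "(\<lambda>x. f (z + c + x)) has_fps_expansion F2"
    unfolding F1_def F2_def by (intro analytic_at_imp_has_fps_expansion an)+
  have G': "(\<lambda>x. G (z + x)) has_fps_expansion fps_expansion G z"
    by (intro analytic_at_imp_has_fps_expansion an)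
  have "(\<lambda>x. f (z + c + x) - f (z + x)) has_fps_expansion F2 - F1"
    by (intro fps_expansion_intros 1)
  moreover have "(\<lambda>x. x ^ n * G (z + x)) has_fps_expansion fps_X ^ n * fps_expansion G z"
    by (intro fps_expansion_intros G')
  moreover have "(\<lambda>x. f (z + c + x) - f (z + x)) = (\<lambda>x. x ^ n * G (z + x))"
    using fG[of "z + _"] by (auto simp: add_ac)
  ultimately have eq: "F2 - F1 = fps_X ^ n * fps_expansion G z"
    using fps_expansion_unique_complex by metis
  have "fps_nth (F2 - F1) n = G z"
    unfolding eq by (simp add: fps_X_power_mult_nth fps_expansion_def)
  hence ne: "fps_nth F1 n \<noteq> fps_nth F2 n"
    using G by auto
  have "{k. \<forall>j\<le>k. fps_nth F1 j = fps_nth F2 j} \<subseteq> {..<n}"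
    using ne by (auto simp: not_le[symmetric])
  hence "card {k. \<forall>j\<le>k. fps_nth F1 j = fps_nth F2 j} \<le> card {..<n}"
    by (intro card_mono) auto
  then show ?thesis
    by (simp add: pair_multiplicity_def F1_def F2_def)
qed

text \<open>
  A possible zero of \<open>f (z + c) - f z\<close> at the origin is split off first. Jensen's formula for the remaining
  factor then has a constant that depends neither on \<open>r\<close> nor on \<open>A\<close>.
\<close>
lemma sum_integrated_pair_count_le:
  assumes f: "f holomorphic_on UNIV" and np: "f (b + c) \<noteq> f b"
  obtains C where "\<And>r A. 1 \<le> r \<Longrightarrow> (\<And>z. cmod z = r \<Longrightarrow> f (z + c) \<noteq> f z) \<Longrightarrow> finite A \<Longrightarrow>
    (\<Sum>a\<in>A. integrated_counting (pair_count c a f) r) \<le> circle_mean r (\<lambda>z. ln (cmod (f (z + c) - f z))) + C"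
proof -
  define g where "g = (\<lambda>z. f (z + c) - f z)"
  have gb: "g b \<noteq> 0" using np by (simp add: g_def)
  have g: "g holomorphic_on UNIV"
    unfolding g_def by (rule holomorphic_difference[OF f])
  obtain k g1 where g1: "g1 holomorphic_on UNIV" "g1 0 \<noteq> 0" and gg1: "\<And>z. g z = (z - 0) ^ k * g1 z"
    using entire_linear_factor[OF g gb] by blast
  define C where "C = - ln (cmod (g1 0))"
  show ?thesis
  proof (rule that[of C])
    fix r and A :: "complex set" assume r: "1 \<le> r" and nz: "\<And>z. cmod z = r \<Longrightarrow> f (z + c) \<noteq> f z" and A: "finite A"
    have nz1: "g1 z \<noteq> 0" if "cmod z = r" for z
      using nz[OF that] gg1[of z] by (auto simp: g_def)
    have "0 < r" using r by simp
    show "(\<Sum>a\<in>A. integrated_counting (pair_count c a f) r)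
        \<le> circle_mean r (\<lambda>z. ln (cmod (f (z + c) - f z))) + C"
    proof (rule Jensen_formula[OF g1(1) \<open>0 < r\<close> nz1 g1(2)])
      fix S n G assume fin: "finite S" and S: "S = {z. cmod z < r \<and> g1 z = 0}"
        and G: "G holomorphic_on UNIV" "\<And>a. a \<in> S \<Longrightarrow> G a \<noteq> 0" "\<And>z. g1 z = (\<Prod>a\<in>S. (z - a) ^ n a) * G z"
        and mean1: "circle_mean r (\<lambda>z. ln (cmod (g1 z))) = ln (cmod (g1 0)) + (\<Sum>a\<in>S. real (n a) * ln (r / cmod a))"
      have mean: "circle_mean r (\<lambda>z. ln (cmod (g z))) = k * ln r + (\<Sum>a\<in>S. n a * ln (r / cmod a)) - C"
      proof -
        have "circle_mean r (\<lambda>z. ln (cmod (g z))) = circle_mean r (\<lambda>z. k * ln r + ln (cmod (g1 z)))"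
          using r nz1 by (intro circle_mean_cong) (auto simp: gg1 norm_mult norm_power ln_mult ln_realpow)
        also have "\<dots> = k * ln r + circle_mean r (\<lambda>z. ln (cmod (g1 z)))"
          using r by (subst circle_mean_add) (auto intro!: continuous_on_ln_cmod g1 nz1)
        finally show ?thesis by (simp add: mean1 C_def)
      qed
      have m0: "pair_multiplicity c f 0 \<le> k"
        by (rule pair_multiplicity_le[OF f g1]) (use gg1 in \<open>simp add: g_def\<close>)
      have S0: "0 \<notin> S" using g1 by (simp add: S)
      have mS: "pair_multiplicity c f z \<le> n z" if z: "z \<in> S" for z
      proof (rule pair_multiplicity_le[OF f, where G = "\<lambda>x. x ^ k * ((\<Prod>a\<in>S - {z}. (x - a) ^ n a) * G x)"])
        show "(\<lambda>x. x ^ k * ((\<Prod>a\<in>S - {z}. (x - a) ^ n a) * G x)) holomorphic_on UNIV"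
          by (intro holomorphic_intros G)
        show "z ^ k * ((\<Prod>a\<in>S - {z}. (z - a) ^ n a) * G z) \<noteq> 0"
          using z S0 G(2) fin by auto
        show "f (x + c) - f x = (x - z) ^ n z * (x ^ k * ((\<Prod>a\<in>S - {z}. (x - a) ^ n a) * G x))" for x
          using gg1[of x] G(3)[of x] prod.remove[OF fin z, of "\<lambda>a. (x - a) ^ n a"]
          by (simp add: g_def mult_ac)
      qed
      define P where "P = (\<lambda>a. {z. cmod z \<le> r \<and> f z = a \<and> f (z + c) = a})"
      have P_sub: "P a - {0} \<subseteq> S" for a
      proof
        fix z assume "z \<in> P a - {0}"
        hence z: "cmod z \<le> r" "f (z + c) = f z" "z \<noteq> 0" by (auto simp: P_def)
        hence "g1 z = 0" using gg1[of z] by (auto simp: g_def)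
        moreover have "cmod z \<noteq> r" using nz z by auto
        ultimately show "z \<in> S" using z by (auto simp: S)
      qed
      have P_fin: "finite (P a)" for a
        using finite_subset[OF P_sub fin] by simp
      have cnt: "integrated_counting (pair_count c a f) r
         = (\<Sum>z\<in>P a - {0}. pair_multiplicity c f z * ln (r / cmod z))
           + real (if f 0 = a \<and> f (0 + c) = a then pair_multiplicity c f 0 else 0) * ln r" for a
        unfolding pair_count_def P_def
        by (rule integrated_counting_sum[OF P_fin[unfolded P_def] \<open>0 < r\<close>])
      have lnr: "0 \<le> ln r" using r by simp
      have lnS: "0 \<le> ln (r / cmod z)" if "z \<in> S" for z
      proof -
        have "z \<noteq> 0" "cmod z < r" using that S0 S by auto
        then show ?thesis by (intro ln_ge_zero) simp
      qed
      have "(\<Sum>a\<in>A. \<Sum>z\<in>P a - {0}. pair_multiplicity c f z * ln (r / cmod z))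
          = (\<Sum>z\<in>(\<Union>a\<in>A. P a - {0}). pair_multiplicity c f z * ln (r / cmod z))"
        using A P_fin by (intro sum.UNION_disjoint[symmetric]) (auto simp: P_def)
      also have "\<dots> \<le> (\<Sum>z\<in>S. pair_multiplicity c f z * ln (r / cmod z))"
        using P_sub lnS fin by (intro sum_mono2) auto
      also have "\<dots> \<le> (\<Sum>z\<in>S. n z * ln (r / cmod z))"
        using mS lnS by (intro sum_mono mult_right_mono) auto
      finally have 1: "(\<Sum>a\<in>A. \<Sum>z\<in>P a - {0}. pair_multiplicity c f z * ln (r / cmod z)) \<le> (\<Sum>z\<in>S. n z * ln (r / cmod z))" .
      have "(\<Sum>a\<in>A. real (if f 0 = a \<and> f (0 + c) = a then pair_multiplicity c f 0 else 0) * ln r)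
          \<le> (\<Sum>a\<in>A. if a = f 0 then k * ln r else 0)"
        using m0 lnr by (intro sum_mono) (auto intro!: mult_right_mono)
      also have "\<dots> \<le> k * ln r"
        using A lnr by (simp add: sum.delta)
      finally have 2: "(\<Sum>a\<in>A. real (if f 0 = a \<and> f (0 + c) = a then pair_multiplicity c f 0 else 0) * ln r) \<le> k * ln r" .
      have "(\<Sum>a\<in>A. integrated_counting (pair_count c a f) r) \<le> circle_mean r (\<lambda>z. ln (cmod (g z))) + C"
        unfolding cnt sum.distrib mean using 1 2 by linarith
      then show "(\<Sum>a\<in>A. integrated_counting (pair_count c a f) r)
          \<le> circle_mean r (\<lambda>z. ln (cmod (f (z + c) - f z))) + C"
        by (simp add: g_def)
    qed
  qed
qed

section \<open>Estimates on circles without zeros\<close>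

text \<open>
  Cauchy's estimate on the unit disc around \<open>z\<close> bounds \<open>|f' z|\<close> by the maximum of \<open>|f|\<close> there. This takes
  the place of the lemma on the logarithmic derivative.
\<close>
lemma proximity_deriv_le:
  assumes f: "f holomorphic_on UNIV" and r: "0 < r"
    and nz: "\<And>z. cmod z = r \<Longrightarrow> f z \<noteq> 0" "\<And>z. cmod z = r \<Longrightarrow> deriv f z \<noteq> 0"
    and M: "circle_distortion_le f 1 r M"
  shows "proximity r (deriv f) \<le> proximity r f + M"
proof -
  obtain E where E: "continuous_on (sphere 0 r) E" "\<And>z. cmod z = r \<Longrightarrow> 0 \<le> E z" "circle_mean r E \<le> M"
    and dist: "\<And>z w. cmod z = r \<Longrightarrow> cmod (w - z) \<le> 1 \<Longrightarrow> cmod (f w) \<le> cmod (f z) * exp (E z)"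
    using M unfolding circle_distortion_le_def by blast
  have f': "deriv f holomorphic_on UNIV" using f by (intro holomorphic_deriv) auto
  note cont = continuous_on_max[OF continuous_on_const continuous_on_ln_cmod]
  have "circle_mean r (\<lambda>z. max 0 (ln (cmod (deriv f z)))) \<le> circle_mean r (\<lambda>z. max 0 (ln (cmod (f z))) + E z)"
  proof (rule circle_mean_mono)
    fix z assume z: "cmod z = r"
    have "cmod ((deriv ^^ 1) f z) \<le> fact 1 * (cmod (f z) * exp (E z)) / 1 ^ 1"
    proof (rule Cauchy_inequality)
      show "cmod (f w) \<le> cmod (f z) * exp (E z)" if "cmod (z - w) = 1" for w
        using that by (intro dist z) (simp add: norm_minus_commute)
    qed (use f in \<open>auto intro: holomorphic_on_subset holomorphic_on_imp_continuous_on\<close>)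
    hence "ln (cmod (deriv f z)) \<le> ln (cmod (f z) * exp (E z))"
      using nz[OF z] by (intro ln_mono) auto
    also have "\<dots> = ln (cmod (f z)) + E z"
      using nz[OF z] by (simp add: ln_mult)
    finally show "max 0 (ln (cmod (deriv f z))) \<le> max 0 (ln (cmod (f z))) + E z"
      using E(2)[OF z] by linarith
  qed (use r nz E in \<open>auto intro!: continuous_on_add cont f f'\<close>)
  also have "\<dots> = circle_mean r (\<lambda>z. max 0 (ln (cmod (f z)))) + circle_mean r E"
    using r by (intro circle_mean_add cont f E nz) auto
  also have "circle_mean r (\<lambda>z. max 0 (ln (cmod (f z)))) = proximity r f"
    unfolding proximity_eq_circle_mean using r nz by (intro circle_mean_cong) (auto simp: log_plus_eq)
  also have "circle_mean r (\<lambda>z. max 0 (ln (cmod (deriv f z)))) = proximity r (deriv f)"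
    unfolding proximity_eq_circle_mean using r nz by (intro circle_mean_cong) (auto simp: log_plus_eq)
  finally show ?thesis using E(3) by simp
qed

text \<open>
  By the mean value inequality \<open>|f (z + c) - f z|\<close> is at most \<open>|c|\<close> times the maximum of \<open>|f'|\<close> on
  \<open>cball z |c|\<close>.
\<close>
lemma circle_mean_difference_le:
  assumes f: "f holomorphic_on UNIV" and r: "0 < r"
    and nz: "\<And>z. cmod z = r \<Longrightarrow> f (z + c) \<noteq> f z" "\<And>z. cmod z = r \<Longrightarrow> deriv f z \<noteq> 0"
    and M: "circle_distortion_le (deriv f) (cmod c) r M"
  shows "circle_mean r (\<lambda>z. ln (cmod (f (z + c) - f z)))
      \<le> proximity r (deriv f) - proximity r (\<lambda>z. 1 / deriv f z) + ln (cmod c) + M"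
proof -
  obtain E where E: "continuous_on (sphere 0 r) E" "circle_mean r E \<le> M"
    and dist: "\<And>z w. cmod z = r \<Longrightarrow> cmod (w - z) \<le> cmod c \<Longrightarrow> cmod (deriv f w) \<le> cmod (deriv f z) * exp (E z)"
    using M unfolding circle_distortion_le_def by blast
  have f': "deriv f holomorphic_on UNIV" using f by (intro holomorphic_deriv) auto
  have c: "c \<noteq> 0" using nz(1)[of "of_real r"] r by auto
  have g: "(\<lambda>z. f (z + c) - f z) holomorphic_on UNIV"
    by (rule holomorphic_difference[OF f])
  have "circle_mean r (\<lambda>z. ln (cmod (f (z + c) - f z)))
      \<le> circle_mean r (\<lambda>z. ln (cmod (deriv f z)) + (ln (cmod c) + E z))"
  proof (rule circle_mean_mono)
    fix z assume z: "cmod z = r"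
    have "cmod (f (z + c) - f z) \<le> (cmod (deriv f z) * exp (E z)) * cmod (z + c - z)"
    proof (rule field_differentiable_bound[OF convex_cball])
      show "(f has_field_derivative deriv f w) (at w within cball z (cmod c))" for w
        using f by (intro holomorphic_derivI[of f UNIV]) auto
      show "cmod (deriv f w) \<le> cmod (deriv f z) * exp (E z)" if "w \<in> cball z (cmod c)" for w
        using that by (intro dist z) (simp add: dist_norm norm_minus_commute)
    qed (auto simp: dist_norm)
    hence "ln (cmod (f (z + c) - f z)) \<le> ln ((cmod (deriv f z) * exp (E z)) * cmod c)"
      using nz(1)[OF z] by (intro ln_mono) auto
    also have "\<dots> = ln (cmod (deriv f z)) + (ln (cmod c) + E z)"
      using nz(2)[OF z] c by (simp add: ln_mult)
    finally show "ln (cmod (f (z + c) - f z)) \<le> ln (cmod (deriv f z)) + (ln (cmod c) + E z)" .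
  qed (use r nz E in \<open>auto intro!: continuous_on_add continuous_on_const continuous_on_ln_cmod g f'\<close>)
  also have "\<dots> = circle_mean r (\<lambda>z. ln (cmod (deriv f z))) + (ln (cmod c) + circle_mean r E)"
    using r nz E by (subst circle_mean_add circle_mean_add[where u = "\<lambda>_. ln (cmod c)"];
      auto intro!: continuous_on_add continuous_on_const continuous_on_ln_cmod f' simp: circle_mean_add)
  also have "circle_mean r (\<lambda>z. ln (cmod (deriv f z))) = proximity r (deriv f) - proximity r (\<lambda>z. 1 / deriv f z)"
    by (rule circle_mean_ln_cmod[OF f' r nz(2)])
  finally show ?thesis using E(2) by simp
qed

lemma deriv_growth:
  assumes f: "f holomorphic_on UNIV" and A: "0 \<le> A"
    and growth: "\<And>r z. r0 \<le> r \<Longrightarrow> cmod z \<le> r \<Longrightarrow> cmod (f z) \<le> exp (A * r powr \<sigma>)"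
    and r: "max 1 r0 \<le> r" and z: "cmod z \<le> r"
  shows "cmod (deriv f z) \<le> exp (A * 2 powr \<bar>\<sigma>\<bar> * r powr \<sigma>)"
proof -
  have "cmod ((deriv ^^ 1) f z) \<le> fact 1 * exp (A * (r + 1) powr \<sigma>) / 1 ^ 1"
  proof (rule Cauchy_inequality)
    fix w assume "cmod (z - w) = 1"
    then show "cmod (f w) \<le> exp (A * (r + 1) powr \<sigma>)"
      using norm_triangle_ineq4[of z "z - w"] r z by (intro growth) auto
  qed (use f in \<open>auto intro: holomorphic_on_subset holomorphic_on_imp_continuous_on\<close>)
  also have "A * (r + 1) powr \<sigma> \<le> A * (2 powr \<bar>\<sigma>\<bar> * r powr \<sigma>)"
  proof (intro mult_left_mono A)
    have "(r + 1) powr \<sigma> = ((r + 1) / r) powr \<sigma> * r powr \<sigma>"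
      using r by (simp flip: powr_mult)
    also have "((r + 1) / r) powr \<sigma> \<le> ((r + 1) / r) powr \<bar>\<sigma>\<bar>"
      using r by (intro powr_mono) (auto simp: field_simps)
    also have "\<dots> \<le> 2 powr \<bar>\<sigma>\<bar>"
      using r by (intro powr_mono2) (auto simp: field_simps)
    finally show "(r + 1) powr \<sigma> \<le> 2 powr \<bar>\<sigma>\<bar> * r powr \<sigma>"
      by (simp add: mult_right_mono)
  qed
  finally show ?thesis by (simp add: mult.assoc)
qed

text \<open>
  The power of \<open>r\<close> is negligible because \<open>r^\<mu> \<le> T(r, F)\<close> eventually, and the constants are negligible
  because the proximity function is unbounded.
\<close>
lemma error_negligible:
  assumes F: "F holomorphic_on UNIV" and nc: "\<not> F constant_on UNIV"
    and low: "ereal \<mu> < lower_growth_order F" and s: "s < \<mu>" and \<epsilon>: "0 < \<epsilon>"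
  shows "\<forall>\<^sub>F r in at_top. (\<forall>z. cmod z = r \<longrightarrow> F z \<noteq> 0) \<longrightarrow> C * (1 + r powr s) + C' \<le> \<epsilon> * proximity r F"
proof -
  have "\<forall>\<^sub>F r in at_top. ereal \<mu> < ereal (ln (characteristic r F) / ln r)"
    using low unfolding lower_growth_order_def by (rule less_LiminfD)
  moreover obtain r0 where r0: "\<And>r. r0 \<le> r \<Longrightarrow> (\<And>z. cmod z = r \<Longrightarrow> F z \<noteq> 0) \<Longrightarrow>
      max 1 (2 / \<epsilon> * (\<bar>C\<bar> + \<bar>C'\<bar>)) \<le> proximity r F"
    using proximity_unbounded[OF F nc] by metis
  moreover have "((\<lambda>r. \<bar>C\<bar> * r powr (s - \<mu>)) \<longlongrightarrow> \<bar>C\<bar> * 0) at_top"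
    using s by (intro tendsto_intros tendsto_neg_powr filterlim_ident) auto
  hence "\<forall>\<^sub>F r in at_top. \<bar>C\<bar> * r powr (s - \<mu>) < \<epsilon> / 2"
    using \<epsilon> by (intro order_tendstoD(2)[where a = "\<epsilon> / 2"]) auto
  ultimately show ?thesis
    using eventually_ge_at_top[of r0] eventually_gt_at_top[of 1]
  proof eventually_elim
    case (elim r)
    then have nz: "\<And>z. cmod z = r \<Longrightarrow> F z \<noteq> 0" by blast
    show ?case
    proof -
      define T where "T = proximity r F"
      have T: "1 \<le> T" "2 / \<epsilon> * (\<bar>C\<bar> + \<bar>C'\<bar>) \<le> T"
        using r0[of r] elim nz by (auto simp: T_def)
      have "\<mu> * ln r < ln T"
        using elim by (simp add: characteristic_entire[OF F] T_def less_divide_eq)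
      hence "exp (\<mu> * ln r) \<le> exp (ln T)" by simp
      hence rT: "r powr \<mu> \<le> T" using T elim by (simp add: powr_def)
      have "\<bar>C\<bar> * r powr s = \<bar>C\<bar> * r powr (s - \<mu>) * r powr \<mu>"
        by (simp flip: powr_add)
      also have "\<dots> \<le> \<epsilon> / 2 * T"
        using elim rT \<epsilon> by (intro mult_mono) auto
      finally have 1: "\<bar>C\<bar> * r powr s \<le> \<epsilon> / 2 * T" .
      have 2: "\<bar>C\<bar> + \<bar>C'\<bar> \<le> \<epsilon> / 2 * T"
        using T(2) \<epsilon> by (simp add: field_simps)
      have "C * r powr s \<le> \<bar>C\<bar> * r powr s" by (intro mult_right_mono) auto
      hence "C * (1 + r powr s) + C' \<le> \<bar>C\<bar> * r powr s + (\<bar>C\<bar> + \<bar>C'\<bar>)"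
        by (simp add: algebra_simps)
      also have "\<dots> \<le> \<epsilon> * T" using 1 2 by simp
      finally show "C * (1 + r powr s) + C' \<le> \<epsilon> * proximity r F" by (simp add: T_def)
    qed
  qed
qed

lemma sum_Liminf_le_ereal:
  fixes u :: "'a \<Rightarrow> real \<Rightarrow> ereal"
  assumes "finite A" "\<And>a. \<forall>\<^sub>F r in at_top. 0 \<le> u a r"
  shows "(\<Sum>a\<in>A. Liminf at_top (u a)) \<le> Liminf at_top (\<lambda>r. \<Sum>a\<in>A. u a r)"
  using assms(1)
proof induction
  case empty
  then show ?case by (simp add: Liminf_const)
next
  case (insert x A)
  have "\<forall>\<^sub>F r in at_top. \<forall>a\<in>A. 0 \<le> u a r"
    using insert(1) assms(2) by (simp add: eventually_ball_finite)
  hence "\<forall>\<^sub>F r in at_top. 0 \<le> (\<Sum>a\<in>A. u a r)"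
    by eventually_elim (auto intro: sum_nonneg)
  hence "Liminf at_top (u x) + Liminf at_top (\<lambda>r. \<Sum>a\<in>A. u a r) \<le> Liminf at_top (\<lambda>r. u x r + (\<Sum>a\<in>A. u a r))"
    using assms(2) by (intro Liminf_add_le) auto
  moreover have "Liminf at_top (u x) + (\<Sum>a\<in>A. Liminf at_top (u a)) \<le> Liminf at_top (u x) + Liminf at_top (\<lambda>r. \<Sum>a\<in>A. u a r)"
    using insert by (intro add_left_mono)
  ultimately show ?case
    using insert by simp
qed

section \<open>The deficiency relation\<close>

text \<open>
  The exponents are chosen with \<open>\<rho>(f) < \<sigma> < \<mu> + 1/2\<close> and \<open>\<mu> < \<mu>(f')\<close>. Then the distortion of
  \<open>f\<close> and that of \<open>f'\<close>, both of order \<open>1 + r^(\<sigma> - 1/2)\<close>, are negligible compared with \<open>T(r, f')\<close>.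
\<close>
lemma eventually_counting_estimate:
  fixes c :: complex and f :: "complex \<Rightarrow> complex"
  assumes f: "f holomorphic_on UNIV" and fin_ord: "growth_order f < \<infinity>" and np: "f (b + c) \<noteq> f b"
    and nc: "\<not> deriv f constant_on UNIV"
    and low: "lower_growth_order (deriv f) > growth_order f - ereal (1 / 2)"
    and \<epsilon>: "0 < \<epsilon>"
  shows "\<forall>\<^sub>F r in at_top. (\<forall>z. cmod z = r \<longrightarrow> f z \<noteq> 0 \<and> deriv f z \<noteq> 0 \<and> f (z + c) \<noteq> f z) \<longrightarrow>
    1 \<le> proximity r (deriv f) \<and>
    (1 - \<epsilon>) * proximity r (deriv f) \<le> proximity r f \<and>
    (\<forall>A. finite A \<longrightarrow> (\<Sum>a\<in>A. integrated_counting (pair_count c a f) r)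
       \<le> (1 + \<epsilon>) * proximity r (deriv f) - proximity r (\<lambda>z. 1 / deriv f z))"
proof -
  have f': "deriv f holomorphic_on UNIV" using f by (intro holomorphic_deriv) auto
  obtain b0 where b0: "f b0 \<noteq> 0"
    using np by metis
  obtain b1 where b1: "deriv f b1 \<noteq> 0"
    using nc unfolding constant_on_def by auto
  obtain \<mu> where \<mu>: "growth_order f - ereal (1 / 2) < ereal \<mu>" "ereal \<mu> < lower_growth_order (deriv f)"
    using ereal_dense2[OF low] by blast
  have "growth_order f < ereal (\<mu> + 1 / 2)"
    using \<mu>(1) by (cases "growth_order f") auto
  then obtain \<sigma> where \<sigma>: "growth_order f < ereal \<sigma>" "\<sigma> < \<mu> + 1 / 2"
    using ereal_dense2 by (metis ereal_less(2) less_ereal.simps(1))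
  obtain A r0 where A: "0 \<le> A" and growth: "\<And>r z. r0 \<le> r \<Longrightarrow> cmod z \<le> r \<Longrightarrow> cmod (f z) \<le> exp (A * r powr \<sigma>)"
    using growth_of_finite_order[OF f b0 \<sigma>(1)] by metis
  have growth': "\<And>r z. max 1 r0 \<le> r \<Longrightarrow> cmod z \<le> r \<Longrightarrow> cmod (deriv f z) \<le> exp (A * 2 powr \<bar>\<sigma>\<bar> * r powr \<sigma>)"
    by (rule deriv_growth[OF f A growth])
  obtain C1 r1 where 1: "\<forall>r\<ge>r1. (\<forall>z. cmod z = r \<longrightarrow> f z \<noteq> 0) \<longrightarrow>
      circle_distortion_le f 1 r (C1 * (1 + r powr (\<sigma> - 1 / 2)))"
    using entire_mean_distortion[OF f b0 zero_le_one A growth] by blast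
  have A2: "0 \<le> A * 2 powr \<bar>\<sigma>\<bar>" using A by simp
  obtain C2 r2 where 2: "\<forall>r\<ge>r2. (\<forall>z. cmod z = r \<longrightarrow> deriv f z \<noteq> 0) \<longrightarrow>
      circle_distortion_le (deriv f) (cmod c) r (C2 * (1 + r powr (\<sigma> - 1 / 2)))"
    using entire_mean_distortion[OF f' b1 norm_ge_zero A2 growth'] by blast
  obtain C3 where 3: "\<And>r A. 1 \<le> r \<Longrightarrow> (\<And>z. cmod z = r \<Longrightarrow> f (z + c) \<noteq> f z) \<Longrightarrow> finite A \<Longrightarrow>
    (\<Sum>a\<in>A. integrated_counting (pair_count c a f) r) \<le> circle_mean r (\<lambda>z. ln (cmod (f (z + c) - f z))) + C3"
    using sum_integrated_pair_count_le[OF f np] by blast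
  have s: "\<sigma> - 1 / 2 < \<mu>" using \<sigma> by simp
  note small = error_negligible[OF f' nc \<mu>(2) s]
  show ?thesis
    using small[OF zero_less_one, of 0 1] small[OF \<epsilon>, of C1 0] small[OF \<epsilon>, of C2 "ln (cmod c) + C3"]
      eventually_ge_at_top[of "max 1 (max r1 r2)"]
  proof eventually_elim
    case (elim r)
    show ?case
    proof (intro impI)
      assume good: "\<forall>z. cmod z = r \<longrightarrow> f z \<noteq> 0 \<and> deriv f z \<noteq> 0 \<and> f (z + c) \<noteq> f z"
      have r: "1 \<le> r" "0 < r" "r1 \<le> r" "r2 \<le> r" using elim by auto
      have e: "1 \<le> proximity r (deriv f)"
        "C1 * (1 + r powr (\<sigma> - 1 / 2)) \<le> \<epsilon> * proximity r (deriv f)"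
        "C2 * (1 + r powr (\<sigma> - 1 / 2)) + (ln (cmod c) + C3) \<le> \<epsilon> * proximity r (deriv f)"
        using elim good by auto
      have T: "proximity r (deriv f) \<le> proximity r f + C1 * (1 + r powr (\<sigma> - 1 / 2))"
        by (rule proximity_deriv_le[OF f r(2)]) (use good 1 r in blast)+
      have D: "circle_mean r (\<lambda>z. ln (cmod (f (z + c) - f z)))
          \<le> proximity r (deriv f) - proximity r (\<lambda>z. 1 / deriv f z) + ln (cmod c) + C2 * (1 + r powr (\<sigma> - 1 / 2))"
        by (rule circle_mean_difference_le[OF f r(2)]) (use good 2 r in blast)+
      show "1 \<le> proximity r (deriv f) \<and>
        (1 - \<epsilon>) * proximity r (deriv f) \<le> proximity r f \<and>
        (\<forall>A. finite A \<longrightarrow> (\<Sum>a\<in>A. integrated_counting (pair_count c a f) r)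
           \<le> (1 + \<epsilon>) * proximity r (deriv f) - proximity r (\<lambda>z. 1 / deriv f z))"
      proof (intro conjI allI impI)
        show "1 \<le> proximity r (deriv f)" by (rule e)
        show "(1 - \<epsilon>) * proximity r (deriv f) \<le> proximity r f"
          using T e(2) by (simp add: algebra_simps)
        fix A :: "complex set" assume "finite A"
        from 3[OF r(1) _ this] good
        have "(\<Sum>a\<in>A. integrated_counting (pair_count c a f) r) \<le> circle_mean r (\<lambda>z. ln (cmod (f (z + c) - f z))) + C3"
          by blast
        then show "(\<Sum>a\<in>A. integrated_counting (pair_count c a f) r)
           \<le> (1 + \<epsilon>) * proximity r (deriv f) - proximity r (\<lambda>z. 1 / deriv f z)"
          using D e(3) by (simp add: algebra_simps)
      qed
    qed
  qed
qed

lemma separated_index_nonneg: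
  assumes f: "f holomorphic_on UNIV" "\<not> f constant_on UNIV"
  shows "\<forall>\<^sub>F r in at_top. 0 \<le> ereal (integrated_counting (pair_count c a f) r / characteristic r f)"
    and "0 \<le> separated_index c a f"
proof -
  show ev: "\<forall>\<^sub>F r in at_top. 0 \<le> ereal (integrated_counting (pair_count c a f) r / characteristic r f)"
    using eventually_ge_at_top[of 1]
    by eventually_elim
       (use integrated_counting_pair_count_nonneg[OF f] in
         \<open>auto simp: characteristic_entire[OF f(1)] proximity_nonneg intro!: divide_nonneg_nonneg\<close>)
  show "0 \<le> separated_index c a f"
    unfolding separated_index_def by (rule Liminf_bounded[OF ev])
qed

text \<open>
  Otherwise some real \<open>y > 1 - \<delta>(0, f')\<close> lies below the lower limit of the quotient. Together with
  \<open>m(r, 1/f') > d T(r, f')\<close> for some \<open>d > 1 - y\<close>, the estimate above is then violated on every large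
  circle without zeros, although such circles exist.
\<close>
lemma finite_sum_separated_index_le:
  fixes c :: complex and f :: "complex \<Rightarrow> complex"
  assumes f: "f holomorphic_on UNIV" and fin_ord: "growth_order f < \<infinity>" and np: "f (b + c) \<noteq> f b"
    and nc: "\<not> deriv f constant_on UNIV"
    and low: "lower_growth_order (deriv f) > growth_order f - ereal (1 / 2)"
    and A: "finite A"
  shows "(\<Sum>a\<in>A. separated_index c a f) \<le> 1 - deficiency_zero (deriv f)"
proof (rule ccontr)
  assume not_le: "\<not> ?thesis"
  have f': "deriv f holomorphic_on UNIV" using f by (intro holomorphic_deriv) auto
  have fnc: "\<not> f constant_on UNIV"
    by (rule not_constant_onI[of f, OF np])
  define N where "N = (\<lambda>r. \<Sum>a\<in>A. integrated_counting (pair_count c a f) r)"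
  have "(\<Sum>a\<in>A. separated_index c a f)
      \<le> Liminf at_top (\<lambda>r. \<Sum>a\<in>A. ereal (integrated_counting (pair_count c a f) r / characteristic r f))"
    unfolding separated_index_def
    by (rule sum_Liminf_le_ereal[OF A separated_index_nonneg(1)[OF f fnc]])
  also have "\<dots> = Liminf at_top (\<lambda>r. ereal (N r / proximity r f))"
    by (simp add: N_def characteristic_entire[OF f] sum_divide_distrib)
  finally have "1 - deficiency_zero (deriv f) < Liminf at_top (\<lambda>r. ereal (N r / proximity r f))"
    using not_le by simp
  then obtain y where y: "1 - deficiency_zero (deriv f) < ereal y"
    and y': "ereal y < Liminf at_top (\<lambda>r. ereal (N r / proximity r f))"
    using ereal_dense2 by blast
  have "ereal (1 - y) < deficiency_zero (deriv f)"
    using y by (cases "deficiency_zero (deriv f)") (auto simp: one_ereal_def)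
  then obtain d where d: "1 - y < d" "ereal d < deficiency_zero (deriv f)"
    using ereal_dense2 by (metis less_ereal.simps(1))
  \<comment> \<open>small enough that \<open>1 + \<epsilon> - d < y * (1 - \<epsilon>)\<close> when \<open>y \<ge> 0\<close>\<close>
  define \<epsilon> where "\<epsilon> = min (1 / 2) ((y - 1 + d) / (2 * (1 + \<bar>y\<bar>)))"
  have \<epsilon>: "0 < \<epsilon>" "\<epsilon> < 1" using d by (auto simp: \<epsilon>_def)
  have "\<epsilon> * (1 + \<bar>y\<bar>) \<le> (y - 1 + d) / (2 * (1 + \<bar>y\<bar>)) * (1 + \<bar>y\<bar>)"
    by (intro mult_right_mono) (auto simp: \<epsilon>_def)
  also have "\<dots> = (y - 1 + d) / 2" by (simp add: field_simps add_nonneg_eq_0_iff)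
  also have "\<dots> < y - 1 + d" using d by simp
  finally have \<epsilon>y: "\<epsilon> * (1 + \<bar>y\<bar>) < y - 1 + d" .
  have "\<forall>\<^sub>F r in at_top. ereal y < ereal (N r / proximity r f)"
    by (rule less_LiminfD[OF y'])
  moreover have "\<forall>\<^sub>F r in at_top. ereal d < ereal (proximity r (\<lambda>z. 1 / deriv f z) / characteristic r (deriv f))"
    using d(2) unfolding deficiency_zero_def by (rule less_LiminfD)
  moreover note eventually_counting_estimate[OF f fin_ord np nc low \<epsilon>(1)]
  ultimately have "\<forall>\<^sub>F r in at_top. \<not> (\<forall>z. cmod z = r \<longrightarrow> f z \<noteq> 0 \<and> deriv f z \<noteq> 0 \<and> f (z + c) \<noteq> f z)"
    using eventually_ge_at_top[of 1]
  proof eventually_elim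
    case (elim r)
    show ?case
    proof
      assume good: "\<forall>z. cmod z = r \<longrightarrow> f z \<noteq> 0 \<and> deriv f z \<noteq> 0 \<and> f (z + c) \<noteq> f z"
      define T where "T = proximity r f"
      define T' where "T' = proximity r (deriv f)"
      define m where "m = proximity r (\<lambda>z. 1 / deriv f z)"
      have est: "1 \<le> T'" "(1 - \<epsilon>) * T' \<le> T" "N r \<le> (1 + \<epsilon>) * T' - m"
        using elim good A by (auto simp: T_def T'_def m_def N_def)
      have "0 < (1 - \<epsilon>) * T'" using est \<epsilon> by simp
      hence T: "0 < T" using est by simp
      have yN: "y * T < N r"
        using elim T by (simp add: T_def less_divide_eq)
      have dm: "d * T' < m"
        using elim est(1) by (simp add: characteristic_entire[OF f'] T'_def m_def less_divide_eq)
      have N_less: "N r < (1 + \<epsilon> - d) * T'"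
        using est(3) dm by (simp add: algebra_simps)
      have N0: "0 \<le> N r"
        unfolding N_def using integrated_counting_pair_count_nonneg[OF f fnc] elim by (intro sum_nonneg) auto
      have "0 < 1 + \<epsilon> - d"
        using N0 N_less est(1) by (metis less_le_trans not_less zero_less_mult_pos2 le_less_trans less_numeral_extra(1))
      have "1 + \<epsilon> - d < y - \<epsilon> * \<bar>y\<bar>"
        using \<epsilon>y by (simp add: algebra_simps)
      moreover from this have "0 < y"
        using \<open>0 < 1 + \<epsilon> - d\<close> \<epsilon> mult_nonneg_nonneg[of \<epsilon> "\<bar>y\<bar>"] by linarith
      ultimately have "(1 + \<epsilon> - d) * T' \<le> (y * (1 - \<epsilon>)) * T'"
        using est(1) by (intro mult_right_mono) (auto simp: algebra_simps)
      also have "\<dots> \<le> y * T"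
        using est(2) \<open>0 < y\<close> by (simp add: mult.assoc)
      finally show False using N_less yN by linarith
    qed
  qed
  then obtain r0 where r0: "\<And>r. r0 \<le> r \<Longrightarrow> \<not> (\<forall>z. cmod z = r \<longrightarrow> f z \<noteq> 0 \<and> deriv f z \<noteq> 0 \<and> f (z + c) \<noteq> f z)"
    by (auto simp: eventually_at_top_linorder)
  have "\<exists>z. f z \<noteq> 0"
    using np by metis
  moreover have "\<exists>z. deriv f z \<noteq> 0"
    using nc unfolding constant_on_def by auto
  moreover have "(\<lambda>z. f (z + c) - f z) holomorphic_on UNIV"
    by (rule holomorphic_difference[OF f])
  ultimately have "countable ({z. f z = 0} \<union> {z. deriv f z = 0} \<union> {z. f (z + c) - f z = 0})"
    using entire_countable_zeros[of f] entire_countable_zeros[of "deriv f"]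
      entire_countable_zeros[of "\<lambda>z. f (z + c) - f z" b] f f' np by auto
  then show False
  proof (rule circle_avoiding_countable[OF _ less_add_one[of r0]])
    fix r assume "r0 < r"
      and "\<And>z. cmod z = r \<Longrightarrow> z \<notin> {z. f z = 0} \<union> {z. deriv f z = 0} \<union> {z. f (z + c) - f z = 0}"
    then show False
      using r0[of r] by auto
  qed
qed

theorem proposition4p3:
  fixes c :: complex and f :: "complex \<Rightarrow> complex"
  assumes "c \<noteq> 0"
    and "f holomorphic_on UNIV"
    and "growth_order f < \<infinity>"
    and "\<not> (\<forall>z. f (z + c) = f z)"
    and "\<not> deriv f constant_on UNIV"
    and "lower_growth_order (deriv f) > growth_order f - ereal (1 / 2)"
  shows "(\<Sum>\<^sub>\<infinity>a::complex. separated_index c a f) \<le> 1 - deficiency_zero (deriv f)"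
proof -
  obtain b where b: "f (b + c) \<noteq> f b" using assms(4) by blast
  have "\<not> f constant_on UNIV"
    by (rule not_constant_onI[of f, OF b])
  hence "(\<Sum>\<^sub>\<infinity>a. separated_index c a f) = (SUP A\<in>{A. finite A \<and> A \<subseteq> UNIV}. \<Sum>a\<in>A. separated_index c a f)"
    by (intro nonneg_infsum_complete separated_index_nonneg assms)
  also have "\<dots> \<le> 1 - deficiency_zero (deriv f)"
    by (intro SUP_least finite_sum_separated_index_le[OF assms(2,3) b assms(5,6)]) simp
  finally show ?thesis .
qed

end
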